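(* A morphism $f\colon(A,\rho)\to(B,\sigma)$ in $\mathsf{PreOrd}(\mathsf{Set})$ is a covering with respect to the adjunction $F\dashv U\colon\mathsf{ParOrd}(\mathsf{Set})\to\mathsf{PreOrd}(\mathsf{Set})$ if and only if the fibre $(f^{-1}(b),\rho)$ belongs to $\mathsf{ParOrd}(\mathsf{Set})$ for every $b\in B$.
   Context: $\mathsf{PreOrd}(\mathsf{Set})$ is the category of preordered sets and monotone maps; $\mathsf{ParOrd}(\mathsf{Set})$ is the full subcategory of partially ordered sets; $U$ is the inclusion and $F$ its left adjoint, sending $(A,\rho)$ to the quotient $A/\!\sim_\rho$ (where $a\sim_\rho a'$ iff $a\rho a'$ and $a'\rho a$) with the partial order $[a]\le[a']\iff a\rho a'$; the unit $\eta_{A}\colon A\to A/\!\sim_\rho$ is the canonical projection. The fibre $f^{-1}(b)$ carries the restriction of $\rho$. Effective descent morphism: a morphism $p\colon E\to B$ of $\mathsf{PreOrd}(\mathsf{Set})$ such that the pullback functor $p^*\colon(\mathsf{PreOrd}(\mathsf{Set})\downarrow B)\to(\mathsf{PreOrd}(\mathsf{Set})\downarrow E)$ is monadic. Trivial covering: a morphism $g\colon X\to Y$ of $\mathsf{PreOrd}(\mathsf{Set})$ whose naturality square ($F(g)\,\eta_X=\eta_Y\, g$) is a pullback. Covering: a morphism $f\colon A\to B$ for which there is an effective descent morphism $p\colon E\to B$ such that the projection $p_1\colon E\times_BA\to E$ of the pullback of $f$ along $p$ is a trivial covering. *)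

theory Defs
  imports Main "HOL-Library.FuncSet"
begin

section \<open>Categories, adjunctions and monadic functors\<close>

text \<open>One type of arrows serves for all categories below: an arrow carries its source and its
  target, and the underlying datum is a function (preordered sets) or an arrow of another
  category (slices, algebras).\<close>

datatype ('x, 'f, 'y) arrow = Arrow (src: 'x) (und: 'f) (tgt: 'y)

record ('o, 'm) cat =
  Obj :: "'o set"
  Arr :: "'m set"
  Dom :: "'m \<Rightarrow> 'o"
  Cod :: "'m \<Rightarrow> 'o"
  Ident :: "'o \<Rightarrow> 'm"
  Comp :: "'m \<Rightarrow> 'm \<Rightarrow> 'm"

definition hom :: "('o, 'm) cat \<Rightarrow> 'o \<Rightarrow> 'o \<Rightarrow> 'm set" where
  "hom C x y = {f \<in> Arr C. Dom C f = x \<and> Cod C f = y}"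

locale category =
  fixes C :: "('o, 'm) cat"
  assumes dom_obj: "f \<in> Arr C \<Longrightarrow> Dom C f \<in> Obj C"
    and cod_obj: "f \<in> Arr C \<Longrightarrow> Cod C f \<in> Obj C"
    and ident_hom: "x \<in> Obj C \<Longrightarrow> Ident C x \<in> hom C x x"
    and comp_hom: "\<lbrakk>f \<in> hom C x y; g \<in> hom C y z\<rbrakk> \<Longrightarrow> Comp C g f \<in> hom C x z"
    and comp_ident_right: "f \<in> hom C x y \<Longrightarrow> Comp C f (Ident C x) = f"
    and comp_ident_left: "f \<in> hom C x y \<Longrightarrow> Comp C (Ident C y) f = f"
    and comp_assoc: "\<lbrakk>f \<in> hom C w x; g \<in> hom C x y; h \<in> hom C y z\<rbrakk>
      \<Longrightarrow> Comp C (Comp C h g) f = Comp C h (Comp C g f)"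

definition iso_in :: "('o, 'm) cat \<Rightarrow> 'm \<Rightarrow> bool" where
  "iso_in C f \<longleftrightarrow> f \<in> Arr C \<and> (\<exists>g \<in> hom C (Cod C f) (Dom C f).
     Comp C g f = Ident C (Dom C f) \<and> Comp C f g = Ident C (Cod C f))"

record ('o, 'm, 'p, 'n) fun_data =
  on_obj :: "'o \<Rightarrow> 'p"
  on_arr :: "'m \<Rightarrow> 'n"

locale functor_between =
  C: category C + D: category D
  for C :: "('o, 'm) cat" and D :: "('p, 'n) cat" +
  fixes F :: "('o, 'm, 'p, 'n) fun_data"
  assumes obj_obj: "x \<in> Obj C \<Longrightarrow> on_obj F x \<in> Obj D"
    and arr_hom: "f \<in> hom C x y \<Longrightarrow> on_arr F f \<in> hom D (on_obj F x) (on_obj F y)"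
    and arr_ident: "x \<in> Obj C \<Longrightarrow> on_arr F (Ident C x) = Ident D (on_obj F x)"
    and arr_comp: "\<lbrakk>f \<in> hom C x y; g \<in> hom C y z\<rbrakk>
      \<Longrightarrow> on_arr F (Comp C g f) = Comp D (on_arr F g) (on_arr F f)"

definition id_functor :: "('o, 'm, 'o, 'm) fun_data" where
  "id_functor = \<lparr>on_obj = (\<lambda>x. x), on_arr = (\<lambda>f. f)\<rparr>"

definition comp_functor ::
  "('p, 'n, 'q, 'k) fun_data \<Rightarrow> ('o, 'm, 'p, 'n) fun_data \<Rightarrow> ('o, 'm, 'q, 'k) fun_data"
  (infixl \<open>\<circ>\<^sub>F\<close> 55) where
  "G \<circ>\<^sub>F F = \<lparr>on_obj = on_obj G \<circ> on_obj F, on_arr = on_arr G \<circ> on_arr F\<rparr>"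

locale nat_trans =
  F: functor_between C D F + G: functor_between C D G
  for C :: "('o, 'm) cat" and D :: "('p, 'n) cat"
    and F G :: "('o, 'm, 'p, 'n) fun_data" +
  fixes t :: "'o \<Rightarrow> 'n"
  assumes component: "x \<in> Obj C \<Longrightarrow> t x \<in> hom D (on_obj F x) (on_obj G x)"
    and naturality: "f \<in> hom C x y \<Longrightarrow> Comp D (t y) (on_arr F f) = Comp D (on_arr G f) (t x)"

definition nat_iso ::
  "('o, 'm) cat \<Rightarrow> ('p, 'n) cat \<Rightarrow> ('o, 'm, 'p, 'n) fun_data \<Rightarrow> ('o, 'm, 'p, 'n) fun_data
    \<Rightarrow> ('o \<Rightarrow> 'n) \<Rightarrow> bool" where
  "nat_iso C D F G t \<longleftrightarrow> nat_trans C D F G t \<and> (\<forall>x \<in> Obj C. iso_in D (t x))"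

definition is_equivalence ::
  "('o, 'm) cat \<Rightarrow> ('p, 'n) cat \<Rightarrow> ('o, 'm, 'p, 'n) fun_data \<Rightarrow> bool" where
  "is_equivalence C D F \<longleftrightarrow> functor_between C D F \<and>
     (\<exists>G s t. functor_between D C G \<and>
        nat_iso C C id_functor (G \<circ>\<^sub>F F) s \<and> nat_iso D D (F \<circ>\<^sub>F G) id_functor t)"

text \<open>\<open>adjunction C D L R u c\<close>: the functor \<open>L\<close> from \<open>C\<close> to \<open>D\<close> is left adjoint to \<open>R\<close>, with
  unit \<open>u\<close> and counit \<open>c\<close>.\<close>

locale adjunction =
  L: functor_between C D L + R: functor_between D C R +
  unit: nat_trans C C id_functor "R \<circ>\<^sub>F L" u +
  counit: nat_trans D D "L \<circ>\<^sub>F R" id_functor c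
  for C :: "('o, 'm) cat" and D :: "('p, 'n) cat"
    and L :: "('o, 'm, 'p, 'n) fun_data" and R :: "('p, 'n, 'o, 'm) fun_data"
    and u :: "'o \<Rightarrow> 'm" and c :: "'p \<Rightarrow> 'n" +
  assumes triangle_L: "x \<in> Obj C
      \<Longrightarrow> Comp D (c (on_obj L x)) (on_arr L (u x)) = Ident D (on_obj L x)"
    and triangle_R: "y \<in> Obj D
      \<Longrightarrow> Comp C (on_arr R (c y)) (u (on_obj R y)) = Ident C (on_obj R y)"

text \<open>The Eilenberg--Moore category of the monad with functor \<open>T\<close>, unit \<open>u\<close> and
  multiplication \<open>m\<close>; an algebra is a pair of an object and its structure arrow.\<close>

definition em_algebras ::
  "('o, 'm) cat \<Rightarrow> ('o, 'm, 'o, 'm) fun_data \<Rightarrow> ('o \<Rightarrow> 'm) \<Rightarrow> ('o \<Rightarrow> 'm) \<Rightarrow> ('o \<times> 'm) set" where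
  "em_algebras C T u m = {(x, a). x \<in> Obj C \<and> a \<in> hom C (on_obj T x) x \<and>
     Comp C a (u x) = Ident C x \<and> Comp C a (on_arr T a) = Comp C a (m x)}"

definition em_category ::
  "('o, 'm) cat \<Rightarrow> ('o, 'm, 'o, 'm) fun_data \<Rightarrow> ('o \<Rightarrow> 'm) \<Rightarrow> ('o \<Rightarrow> 'm)
    \<Rightarrow> ('o \<times> 'm, ('o \<times> 'm, 'm, 'o \<times> 'm) arrow) cat" where
  "em_category C T u m =
     \<lparr>Obj = em_algebras C T u m,
      Arr = {Arrow (x, a) h (y, b) | x a h y b.
        (x, a) \<in> em_algebras C T u m \<and> (y, b) \<in> em_algebras C T u m \<and>
        h \<in> hom C x y \<and> Comp C h a = Comp C b (on_arr T h)},
      Dom = src, Cod = tgt,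
      Ident = (\<lambda>(x, a). Arrow (x, a) (Ident C x) (x, a)),
      Comp = (\<lambda>g f. Arrow (src f) (Comp C (und g) (und f)) (tgt g))\<rparr>"

definition comparison_functor ::
  "('p, 'n) cat \<Rightarrow> ('p, 'n, 'o, 'm) fun_data \<Rightarrow> ('p \<Rightarrow> 'n)
    \<Rightarrow> ('p, 'n, 'o \<times> 'm, ('o \<times> 'm, 'm, 'o \<times> 'm) arrow) fun_data" where
  "comparison_functor D R c =
     \<lparr>on_obj = (\<lambda>y. (on_obj R y, on_arr R (c y))),
      on_arr = (\<lambda>f. Arrow (on_obj R (Dom D f), on_arr R (c (Dom D f)))
                          (on_arr R f)
                          (on_obj R (Cod D f), on_arr R (c (Cod D f))))\<rparr>"

definition monadic :: "('p, 'n) cat \<Rightarrow> ('o, 'm) cat \<Rightarrow> ('p, 'n, 'o, 'm) fun_data \<Rightarrow> bool" where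
  "monadic D C R \<longleftrightarrow> (\<exists>L u c. adjunction C D L R u c \<and>
     is_equivalence D
       (em_category C (R \<circ>\<^sub>F L) u (\<lambda>x. on_arr R (c (on_obj L x))))
       (comparison_functor D R c))"

definition slice :: "('o, 'm) cat \<Rightarrow> 'o \<Rightarrow> ('m, ('m, 'm, 'm) arrow) cat" where
  "slice C b =
     \<lparr>Obj = {g \<in> Arr C. Cod C g = b},
      Arr = {Arrow g h g' | g h g'. g \<in> Arr C \<and> Cod C g = b \<and> g' \<in> Arr C \<and> Cod C g' = b \<and>
        h \<in> hom C (Dom C g) (Dom C g') \<and> Comp C g' h = g},
      Dom = src, Cod = tgt,
      Ident = (\<lambda>g. Arrow g (Ident C (Dom C g)) g),
      Comp = (\<lambda>k h. Arrow (src h) (Comp C (und k) (und h)) (tgt k))\<rparr>"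


section \<open>Preordered sets\<close>

text \<open>The category of sets is given by a type \<open>'u\<close> and a notion of smallness for subsets of
  \<open>'u\<close>: its objects are the small subsets of \<open>'u\<close>. The closure conditions hold for the members
  of a Grothendieck universe (with \<open>'u\<close> the type of elements of the universe), and also if
  \<open>'u\<close> is any infinite type all of whose subsets count as small.\<close>

locale set_universe =
  fixes small :: "'u set \<Rightarrow> bool"
  assumes infinite_univ: "infinite (UNIV :: 'u set)"
    and small_finite: "finite A \<Longrightarrow> small A"
    and small_subset: "\<lbrakk>small A; B \<subseteq> A\<rbrakk> \<Longrightarrow> small B"
    and small_image: "small A \<Longrightarrow> small ((f :: 'u \<Rightarrow> 'u) ` A)"
    and small_UN: "\<lbrakk>small I; \<And>i. i \<in> I \<Longrightarrow> small (X i)\<rbrakk> \<Longrightarrow> small (\<Union>i\<in>I. X i)"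

type_synonym 'a preset = "'a set \<times> 'a rel"
type_synonym ('a, 'b) monotone_map = "('a preset, 'a \<Rightarrow> 'b, 'b preset) arrow"

definition preordered_set :: "'a preset \<Rightarrow> bool" where
  "preordered_set X \<longleftrightarrow> preorder_on (fst X) (snd X)"

text \<open>Underlying functions are extensional (undefined outside the carrier), so that
  equality of arrows is equality of maps.\<close>

definition monotone_map :: "('a, 'b) monotone_map \<Rightarrow> bool" where
  "monotone_map f \<longleftrightarrow> preordered_set (src f) \<and> preordered_set (tgt f) \<and>
     und f \<in> fst (src f) \<rightarrow>\<^sub>E fst (tgt f) \<and>
     (\<forall>x y. (x, y) \<in> snd (src f) \<longrightarrow> (und f x, und f y) \<in> snd (tgt f))"

definition comp_map ::
  "('b, 'c) monotone_map \<Rightarrow> ('a, 'b) monotone_map \<Rightarrow> ('a, 'c) monotone_map" where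
  "comp_map g f = Arrow (src f) (compose (fst (src f)) (und g) (und f)) (tgt g)"

definition PreOrd :: "('u set \<Rightarrow> bool) \<Rightarrow> ('u preset, ('u, 'u) monotone_map) cat" where
  "PreOrd small =
     \<lparr>Obj = {X. small (fst X) \<and> preordered_set X},
      Arr = {f. small (fst (src f)) \<and> small (fst (tgt f)) \<and> monotone_map f},
      Dom = src, Cod = tgt,
      Ident = (\<lambda>X. Arrow X (\<lambda>x\<in>fst X. x) X),
      Comp = comp_map\<rparr>"

definition ParOrd :: "('u set \<Rightarrow> bool) \<Rightarrow> ('u preset, ('u, 'u) monotone_map) cat" where
  "ParOrd small = (PreOrd small)
     \<lparr>Obj := {X \<in> Obj (PreOrd small). partial_order_on (fst X) (snd X)},
      Arr := {f \<in> Arr (PreOrd small). partial_order_on (fst (src f)) (snd (src f)) \<and>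
        partial_order_on (fst (tgt f)) (snd (tgt f))}\<rparr>"

definition fibre :: "('a, 'b) monotone_map \<Rightarrow> 'b \<Rightarrow> 'a preset" where
  "fibre f b = (let A = {a \<in> fst (src f). und f a = b} in (A, Restr (snd (src f)) A))"


section \<open>Pullback functors and effective descent\<close>

text \<open>Ordered pairs are coded in \<open>'u\<close> by an arbitrary injection, which exists as \<open>'u\<close> is
  infinite.\<close>

definition pair_code :: "'u \<times> 'u \<Rightarrow> 'u" where
  "pair_code = (SOME h. inj h)"

abbreviation code_fst :: "'u \<Rightarrow> 'u" where "code_fst z \<equiv> fst (inv pair_code z)"
abbreviation code_snd :: "'u \<Rightarrow> 'u" where "code_snd z \<equiv> snd (inv pair_code z)"

definition fibre_product :: "('u, 'u) monotone_map \<Rightarrow> ('u, 'u) monotone_map \<Rightarrow> 'u preset" where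
  "fibre_product p f =
     (pair_code ` {(e, a). e \<in> fst (src p) \<and> a \<in> fst (src f) \<and> und p e = und f a},
      {(pair_code (e, a), pair_code (e', a')) | e a e' a'.
        und p e = und f a \<and> und p e' = und f a' \<and>
        (e, e') \<in> snd (src p) \<and> (a, a') \<in> snd (src f)})"

definition pullback_proj1 ::
  "('u, 'u) monotone_map \<Rightarrow> ('u, 'u) monotone_map \<Rightarrow> ('u, 'u) monotone_map" where
  "pullback_proj1 p f =
     Arrow (fibre_product p f) (\<lambda>z \<in> fst (fibre_product p f). code_fst z) (src p)"

definition pullback_functor ::
  "('u, 'u) monotone_map \<Rightarrow>
    (('u, 'u) monotone_map,
     (('u, 'u) monotone_map, ('u, 'u) monotone_map, ('u, 'u) monotone_map) arrow,
     ('u, 'u) monotone_map,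
     (('u, 'u) monotone_map, ('u, 'u) monotone_map, ('u, 'u) monotone_map) arrow) fun_data" where
  "pullback_functor p =
     \<lparr>on_obj = pullback_proj1 p,
      on_arr = (\<lambda>h. Arrow
        (pullback_proj1 p (src h))
        (Arrow (fibre_product p (src h))
          (\<lambda>z \<in> fst (fibre_product p (src h)).
             pair_code (code_fst z, und (und h) (code_snd z)))
          (fibre_product p (tgt h)))
        (pullback_proj1 p (tgt h)))\<rparr>"

definition effective_descent :: "('u set \<Rightarrow> bool) \<Rightarrow> ('u, 'u) monotone_map \<Rightarrow> bool" where
  "effective_descent small p \<longleftrightarrow> p \<in> Arr (PreOrd small) \<and>
     monadic (slice (PreOrd small) (tgt p)) (slice (PreOrd small) (src p)) (pullback_functor p)"


section \<open>The reflection into partially ordered sets, and coverings\<close>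

definition sim :: "'a preset \<Rightarrow> 'a rel" where
  "sim X = snd X \<inter> (snd X)\<inverse>"

definition F_obj :: "'a preset \<Rightarrow> 'a set preset" where
  "F_obj X = (fst X // sim X, {(sim X `` {a}, sim X `` {a'}) | a a'. (a, a') \<in> snd X})"

definition eta :: "'a preset \<Rightarrow> ('a, 'a set) monotone_map" where
  "eta X = Arrow X (\<lambda>a \<in> fst X. sim X `` {a}) (F_obj X)"

text \<open>For a class \<open>K = [a]\<close>, the set of all elements equivalent to some element of the image
  of \<open>K\<close> under \<open>g\<close> is the class \<open>[g a]\<close>.\<close>

definition F_arr :: "('a, 'b) monotone_map \<Rightarrow> ('a set, 'b set) monotone_map" where
  "F_arr g = Arrow (F_obj (src g))
     (\<lambda>K \<in> fst (F_obj (src g)). sim (tgt g) `` (und g ` K)) (F_obj (tgt g))"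

text \<open>The square with \<open>f\<close> after \<open>p\<close> equal to \<open>g\<close> after \<open>q\<close> is a pullback: the universal
  property is required for all small preordered sets over the type \<open>'u\<close>. The corners may live
  over other types, because \<open>F_obj X\<close> consists of subsets of the carrier of \<open>X\<close>.\<close>

definition pullback_square ::
  "('u set \<Rightarrow> bool) \<Rightarrow> ('p, 'a) monotone_map \<Rightarrow> ('p, 'b) monotone_map
    \<Rightarrow> ('a, 'c) monotone_map \<Rightarrow> ('b, 'c) monotone_map \<Rightarrow> bool" where
  "pullback_square small p q f g \<longleftrightarrow>
     monotone_map p \<and> monotone_map q \<and> monotone_map f \<and> monotone_map g \<and>
     src p = src q \<and> tgt p = src f \<and> tgt q = src g \<and> tgt f = tgt g \<and>
     comp_map f p = comp_map g q \<and>
     (\<forall>(v :: ('u, 'a) monotone_map) (w :: ('u, 'b) monotone_map).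
        small (fst (src v)) \<and> monotone_map v \<and> monotone_map w \<and> src v = src w \<and>
        tgt v = src f \<and> tgt w = src g \<and> comp_map f v = comp_map g w \<longrightarrow>
        (\<exists>!k :: ('u, 'p) monotone_map. monotone_map k \<and> src k = src v \<and> tgt k = src p \<and>
           comp_map p k = v \<and> comp_map q k = w))"

definition trivial_covering :: "('u set \<Rightarrow> bool) \<Rightarrow> ('u, 'u) monotone_map \<Rightarrow> bool" where
  "trivial_covering small g \<longleftrightarrow> g \<in> Arr (PreOrd small) \<and>
     pullback_square small g (eta (src g)) (eta (tgt g)) (F_arr g)"

definition covering :: "('u set \<Rightarrow> bool) \<Rightarrow> ('u, 'u) monotone_map \<Rightarrow> bool" where
  "covering small f \<longleftrightarrow> f \<in> Arr (PreOrd small) \<and>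
     (\<exists>p. effective_descent small p \<and> tgt p = tgt f \<and>
        trivial_covering small (pullback_proj1 p f))"

end

theory Submission
  imports Defs
begin

text \<open>If \<open>f\<close> becomes a trivial covering after pulling back along an effective descent morphism
  \<open>p\<close>, then equivalent elements \<open>a\<close>, \<open>a'\<close> of the fibre over \<open>b = p e\<close> give equivalent elements
  \<open>(e, a)\<close>, \<open>(e, a')\<close> of the pullback with the same projection, so they agree; such an \<open>e\<close> exists
  because effective descent morphisms are surjective. Conversely, a map that lifts all chains
  \<open>b\<^sub>0 \<le> b\<^sub>1 \<le> b\<^sub>2\<close> is an effective descent morphism: an algebra for the induced monad is a
  preordered set over \<open>E\<close> whose fibres over \<open>e\<close>, \<open>e'\<close> with \<open>p e = p e'\<close> are identified by compatible
  transport maps, and lifting of chains makes the induced relation on its quotient over \<open>B\<close> transitive. Such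
  a map onto \<open>B\<close> can be chosen with a partially ordered domain. If the fibres of \<open>f\<close> are
  partially ordered, then so is the pullback of \<open>f\<close>, and a monotone map between partially ordered
  sets is a trivial covering.\<close>

section \<open>Functors and equivalences\<close>

lemma hom_iff: "f \<in> hom C x y \<longleftrightarrow> f \<in> Arr C \<and> Dom C f = x \<and> Cod C f = y"
  by (auto simp: hom_def)

context category
begin

lemma hom_obj: "f \<in> hom C x y \<Longrightarrow> x \<in> Obj C \<and> y \<in> Obj C"
  using dom_obj cod_obj by (auto simp: hom_iff)

lemma iso_inI:
  assumes "f \<in> hom C x y" "g \<in> hom C y x" "Comp C g f = Ident C x" "Comp C f g = Ident C y"
  shows "iso_in C f"
  using assms unfolding iso_in_def by (auto simp: hom_iff[of f])

lemma iso_inE: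
  assumes "iso_in C f" "f \<in> hom C x y"
  obtains g where "g \<in> hom C y x" "Comp C g f = Ident C x" "Comp C f g = Ident C y"
  using assms unfolding iso_in_def by (auto simp: hom_iff)

lemma functor_id: "functor_between C C id_functor"
  by unfold_locales (auto simp: id_functor_def)

end

lemma functor_comp:
  assumes "functor_between C D F" "functor_between D E G"
  shows "functor_between C E (G \<circ>\<^sub>F F)"
proof -
  interpret F: functor_between C D F by fact
  interpret G: functor_between D E G by fact
  show ?thesis
    by unfold_locales
      (simp_all add: comp_functor_def F.obj_obj G.obj_obj F.arr_ident G.arr_ident
        F.arr_hom G.arr_hom F.arr_comp G.arr_comp[OF F.arr_hom F.arr_hom])
qed

text \<open>A quasi-inverse is built by choice: \<open>g d\<close> is an object whose image is
  isomorphic to \<open>d\<close>, and an arrow is conjugated by the chosen isomorphisms and then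
  lifted along the fully faithful \<open>F\<close>. This is how the comparison functor is shown to
  be an equivalence.\<close>

lemma equivalence_if_full_faithful_ess_surj:
  assumes F: "functor_between C D F"
    and ff: "\<And>x y k. \<lbrakk>x \<in> Obj C; y \<in> Obj C; k \<in> hom D (on_obj F x) (on_obj F y)\<rbrakk>
      \<Longrightarrow> \<exists>!h. h \<in> hom C x y \<and> on_arr F h = k"
    and eso: "\<And>d. d \<in> Obj D \<Longrightarrow> \<exists>x \<in> Obj C. \<exists>i \<in> hom D (on_obj F x) d. iso_in D i"
  shows "is_equivalence C D F"
proof -
  interpret F: functor_between C D F by fact
  \<comment> \<open>The membership of \<open>d\<close> stands below the existential quantifiers so
    that the choice functions are defined on the whole type.\<close>
  have "\<forall>d. \<exists>x i j. d \<in> Obj D \<longrightarrow> x \<in> Obj C \<and> i \<in> hom D (on_obj F x) d \<and> j \<in> hom D d (on_obj F x)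
      \<and> Comp D j i = Ident D (on_obj F x) \<and> Comp D i j = Ident D d"
    using eso F.D.iso_inE by metis
  then obtain g i j where g: "\<And>d. d \<in> Obj D \<Longrightarrow> g d \<in> Obj C"
    and i: "\<And>d. d \<in> Obj D \<Longrightarrow> i d \<in> hom D (on_obj F (g d)) d"
    and j: "\<And>d. d \<in> Obj D \<Longrightarrow> j d \<in> hom D d (on_obj F (g d))"
    and ji: "\<And>d. d \<in> Obj D \<Longrightarrow> Comp D (j d) (i d) = Ident D (on_obj F (g d))"
    and ij: "\<And>d. d \<in> Obj D \<Longrightarrow> Comp D (i d) (j d) = Ident D d"
    by metis
  define lift where "lift x y k = (THE h. h \<in> hom C x y \<and> on_arr F h = k)" for x y k
  have lift: "lift x y k \<in> hom C x y" "on_arr F (lift x y k) = k"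
    if "x \<in> Obj C" "y \<in> Obj C" "k \<in> hom D (on_obj F x) (on_obj F y)" for x y k
    using theI'[OF ff[OF that]] by (auto simp: lift_def)
  have faithful: "h = h'" if "h \<in> hom C x y" "h' \<in> hom C x y" "on_arr F h = on_arr F h'" for h h' x y
    using ff[of x y "on_arr F h"] that F.arr_hom F.C.hom_obj by metis
  \<comment> \<open>\<open>conj k\<close> is \<open>k\<close> carried along the chosen isomorphisms
    to an arrow between images of objects of \<open>C\<close>, where it has a unique lift.\<close>
  define conj where "conj k = Comp D (j (Cod D k)) (Comp D k (i (Dom D k)))" for k
  define G where "G = \<lparr>on_obj = g, on_arr = (\<lambda>k. lift (g (Dom D k)) (g (Cod D k)) (conj k))\<rparr>"
  have conj_hom: "conj k \<in> hom D (on_obj F (g x)) (on_obj F (g y))" if "k \<in> hom D x y" for k x y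
  proof -
    have "Dom D k = x" "Cod D k = y" using that by (auto simp: hom_iff)
    then show ?thesis
      using F.D.comp_hom[OF F.D.comp_hom[OF i that] j] F.D.hom_obj[OF that] by (simp add: conj_def)
  qed
  have G_hom: "on_arr G k \<in> hom C (g x) (g y)" and FG: "on_arr F (on_arr G k) = conj k"
    if "k \<in> hom D x y" for k x y
    using lift[OF g g conj_hom] F.D.hom_obj[OF that] that by (auto simp: G_def hom_iff)
  have conj_eq: "conj k = Comp D (j y) (Comp D k (i x))" if "k \<in> hom D x y" for k x y
    using that by (auto simp: conj_def hom_iff)
  have i_conj: "Comp D (i y) (conj k) = Comp D k (i x)" if k: "k \<in> hom D x y" for k x y
    using F.D.hom_obj[OF k] F.D.comp_assoc[OF F.D.comp_hom[OF i k] j i] ij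
      F.D.comp_ident_left[OF F.D.comp_hom[OF i k]] k
    by (simp add: conj_eq)
  have conj_comp: "conj (Comp D l k) = Comp D (conj l) (conj k)"
    if k: "k \<in> hom D x y" and l: "l \<in> hom D y z" for k l x y z
  proof -
    have o: "x \<in> Obj D" "y \<in> Obj D" "z \<in> Obj D" using F.D.hom_obj k l by auto
    have "Comp D (conj l) (conj k) = Comp D (j z) (Comp D (Comp D l (i y)) (conj k))"
      using F.D.comp_assoc[OF conj_hom[OF k] F.D.comp_hom[OF i l] j] o by (simp add: conj_eq[OF l])
    also have "Comp D (Comp D l (i y)) (conj k) = Comp D l (Comp D k (i x))"
      using F.D.comp_assoc[OF conj_hom[OF k] i l] o i_conj[OF k] by simp
    also have "\<dots> = Comp D (Comp D l k) (i x)"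
      using F.D.comp_assoc[OF i k l] o by simp
    finally show ?thesis using conj_eq[OF F.D.comp_hom[OF k l]] by simp
  qed
  \<comment> \<open>By faithfulness the functor laws for \<open>G\<close> can be checked after
    applying \<open>F\<close>, where they become laws for \<open>conj\<close>.\<close>
  have GF: "functor_between D C G"
  proof
    show "on_obj G x \<in> Obj C" if "x \<in> Obj D" for x using g that by (simp add: G_def)
    show "on_arr G f \<in> hom C (on_obj G x) (on_obj G y)" if "f \<in> hom D x y" for f x y
      using G_hom[OF that] by (simp add: G_def)
    show "on_arr G (Ident D x) = Ident C (on_obj G x)" if "x \<in> Obj D" for x
    proof (rule faithful)
      show "on_arr G (Ident D x) \<in> hom C (g x) (g x)"
        using G_hom[OF F.D.ident_hom[OF that]] .
      show "Ident C (on_obj G x) \<in> hom C (g x) (g x)"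
        using F.C.ident_hom[OF g[OF that]] by (simp add: G_def)
      show "on_arr F (on_arr G (Ident D x)) = on_arr F (Ident C (on_obj G x))"
        using FG[OF F.D.ident_hom[OF that]] conj_eq[OF F.D.ident_hom[OF that]]
          F.D.comp_ident_left[OF i[OF that]] ji[OF that] F.arr_ident[OF g[OF that]]
        by (simp add: G_def)
    qed
    show "on_arr G (Comp D l k) = Comp C (on_arr G l) (on_arr G k)"
      if k: "k \<in> hom D x y" and l: "l \<in> hom D y z" for k l x y z
    proof (rule faithful)
      show "on_arr G (Comp D l k) \<in> hom C (g x) (g z)"
        using G_hom[OF F.D.comp_hom[OF k l]] .
      show "Comp C (on_arr G l) (on_arr G k) \<in> hom C (g x) (g z)"
        using F.C.comp_hom[OF G_hom[OF k] G_hom[OF l]] .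
      show "on_arr F (on_arr G (Comp D l k)) = on_arr F (Comp C (on_arr G l) (on_arr G k))"
        using FG[OF F.D.comp_hom[OF k l]] conj_comp[OF k l] FG[OF k] FG[OF l]
          F.arr_comp[OF G_hom[OF k] G_hom[OF l]] by simp
    qed
  qed
  \<comment> \<open>The unit component at \<open>x\<close> is the lift of \<open>j\<close>; the lift
    of the inverse isomorphism \<open>i\<close> will be its inverse.\<close>
  define s where "s x = lift x (g (on_obj F x)) (j (on_obj F x))" for x
  have s: "s x \<in> hom C x (g (on_obj F x))" "on_arr F (s x) = j (on_obj F x)" if "x \<in> Obj C" for x
    using lift[OF that g j] F.obj_obj[OF that] by (auto simp: s_def)
  have Gobj: "on_obj G = g" by (simp add: G_def)
  have GFs: "nat_trans C C id_functor (G \<circ>\<^sub>F F) s"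
  proof (rule nat_trans.intro[OF F.C.functor_id functor_comp[OF F GF]], unfold_locales)
    show "s x \<in> hom C (on_obj id_functor x) (on_obj (G \<circ>\<^sub>F F) x)" if "x \<in> Obj C" for x
      using s[OF that] by (simp add: id_functor_def comp_functor_def Gobj)
    show "Comp C (s y) (on_arr id_functor h) = Comp C (on_arr (G \<circ>\<^sub>F F) h) (s x)"
      if h: "h \<in> hom C x y" for h x y
    proof (rule faithful)
      have o: "x \<in> Obj C" "y \<in> Obj C" using F.C.hom_obj[OF h] by auto
      note Fo = o[THEN F.obj_obj]
      note Fh = F.arr_hom[OF h]
      show "Comp C (s y) (on_arr id_functor h) \<in> hom C x (g (on_obj F y))"
        using F.C.comp_hom[OF h s(1)[OF o(2)]] by (simp add: id_functor_def)
      show "Comp C (on_arr (G \<circ>\<^sub>F F) h) (s x) \<in> hom C x (g (on_obj F y))"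
        using F.C.comp_hom[OF s(1)[OF o(1)] G_hom[OF Fh]] by (simp add: comp_functor_def)
      have "Comp D (conj (on_arr F h)) (j (on_obj F x))
          = Comp D (j (on_obj F y)) (Comp D (Comp D (on_arr F h) (i (on_obj F x))) (j (on_obj F x)))"
        using F.D.comp_assoc[OF j F.D.comp_hom[OF i Fh] j] Fo by (simp add: conj_eq[OF Fh])
      also have "Comp D (Comp D (on_arr F h) (i (on_obj F x))) (j (on_obj F x)) = on_arr F h"
        using F.D.comp_assoc[OF j i Fh] Fo ij F.D.comp_ident_right[OF Fh] by simp
      finally show "on_arr F (Comp C (s y) (on_arr id_functor h))
          = on_arr F (Comp C (on_arr (G \<circ>\<^sub>F F) h) (s x))"
        using F.arr_comp[OF h s(1)[OF o(2)]] F.arr_comp[OF s(1)[OF o(1)] G_hom[OF Fh]] s(2) o FG[OF Fh]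
        by (simp add: id_functor_def comp_functor_def)
    qed
  qed
  have s_iso: "iso_in C (s x)" if x: "x \<in> Obj C" for x
  proof -
    let ?y = "on_obj F x"
    note y = F.obj_obj[OF x]
    define r where "r = lift (g ?y) x (i ?y)"
    have r: "r \<in> hom C (g ?y) x" "on_arr F r = i ?y" using lift[OF g[OF y] x i[OF y]] by (auto simp: r_def)
    show ?thesis
    proof (rule F.C.iso_inI[OF s(1)[OF x] r(1)])
      show "Comp C r (s x) = Ident C x"
        by (rule faithful[OF F.C.comp_hom[OF s(1)[OF x] r(1)] F.C.ident_hom[OF x]])
          (simp add: F.arr_comp[OF s(1)[OF x] r(1)] s(2)[OF x] r(2) ij[OF y] F.arr_ident[OF x])
      show "Comp C (s x) r = Ident C (g ?y)"
        by (rule faithful[OF F.C.comp_hom[OF r(1) s(1)[OF x]] F.C.ident_hom[OF g[OF y]]])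
          (simp add: F.arr_comp[OF r(1) s(1)[OF x]] s(2)[OF x] r(2) ji[OF y] F.arr_ident[OF g[OF y]])
    qed
  qed
  have FGi: "nat_trans D D (F \<circ>\<^sub>F G) id_functor i"
  proof (rule nat_trans.intro[OF functor_comp[OF GF F] F.D.functor_id], unfold_locales)
    show "i x \<in> hom D (on_obj (F \<circ>\<^sub>F G) x) (on_obj id_functor x)" if "x \<in> Obj D" for x
      using i[OF that] by (simp add: id_functor_def comp_functor_def Gobj)
    show "Comp D (i y) (on_arr (F \<circ>\<^sub>F G) h) = Comp D (on_arr id_functor h) (i x)"
      if h: "h \<in> hom D x y" for h x y
      using i_conj[OF h] FG[OF h] by (simp add: id_functor_def comp_functor_def)
  qed
  have i_iso: "iso_in D (i x)" if "x \<in> Obj D" for x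
    using F.D.iso_inI[OF i j ji ij] that by blast
  show ?thesis
    unfolding is_equivalence_def nat_iso_def
    using F GF GFs s_iso FGi i_iso by blast
qed

text \<open>A quasi-inverse sends \<open>k\<close> to an arrow that is composed with the unit at
  \<open>x\<close> and the inverse of the unit at \<open>y\<close>. It serves to derive a
  contradiction when \<open>C\<close> has no arrow from \<open>x\<close> to
  \<open>y\<close>.\<close>

lemma equivalence_reflects_hom:
  assumes F: "is_equivalence C D F" and x: "x \<in> Obj C" and y: "y \<in> Obj C"
    and k: "k \<in> hom D (on_obj F x) (on_obj F y)"
  shows "\<exists>h. h \<in> hom C x y"
proof -
  obtain G s where G: "functor_between D C G" and s: "nat_trans C C id_functor (G \<circ>\<^sub>F F) s"
    and iso: "\<And>z. z \<in> Obj C \<Longrightarrow> iso_in C (s z)"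
    using F unfolding is_equivalence_def nat_iso_def by blast
  interpret G: functor_between D C G by (rule G)
  interpret s: nat_trans C C id_functor "G \<circ>\<^sub>F F" s by (rule s)
  have sx: "s x \<in> hom C x (on_obj G (on_obj F x))" and sy: "s y \<in> hom C y (on_obj G (on_obj F y))"
    using s.component x y by (auto simp: id_functor_def comp_functor_def)
  obtain r where r: "r \<in> hom C (on_obj G (on_obj F y)) y"
    using G.D.iso_inE[OF iso[OF y] sy] by blast
  show ?thesis
    using G.D.comp_hom[OF sx G.D.comp_hom[OF G.arr_hom[OF k] r]] by blast
qed

section \<open>Slices and Eilenberg--Moore categories\<close>

lemma slice_simps [simp]:
  "Obj (slice C b) = {g \<in> Arr C. Cod C g = b}"
  "Ident (slice C b) g = Arrow g (Ident C (Dom C g)) g"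
  "Comp (slice C b) k h = Arrow (src h) (Comp C (und k) (und h)) (tgt k)"
  by (auto simp: slice_def)

lemma slice_hom_iff:
  "k \<in> hom (slice C b) g g' \<longleftrightarrow>
     g \<in> Arr C \<and> Cod C g = b \<and> g' \<in> Arr C \<and> Cod C g' = b \<and>
     src k = g \<and> tgt k = g' \<and> und k \<in> hom C (Dom C g) (Dom C g') \<and> Comp C g' (und k) = g"
  by (cases k) (auto simp: slice_def hom_iff[of k] hom_iff[of "Arrow _ _ _"])

lemma (in category) slice_category: "category (slice C b)"
proof
  fix x y z f g h w
  have arr: "k \<in> hom (slice C b) (Dom (slice C b) k) (Cod (slice C b) k)" if "k \<in> Arr (slice C b)" for k
    using that by (simp add: hom_iff)
  show "Dom (slice C b) f \<in> Obj (slice C b)" if "f \<in> Arr (slice C b)"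
    using arr[OF that] unfolding slice_hom_iff by simp
  show "Cod (slice C b) f \<in> Obj (slice C b)" if "f \<in> Arr (slice C b)"
    using arr[OF that] unfolding slice_hom_iff by simp
  show "Ident (slice C b) x \<in> hom (slice C b) x x" if "x \<in> Obj (slice C b)"
    using that ident_hom[OF dom_obj] comp_ident_right[of x "Dom C x" b]
    unfolding slice_hom_iff by (simp add: hom_iff[of x])
  show "Comp (slice C b) g f \<in> hom (slice C b) x z"
    if "f \<in> hom (slice C b) x y" "g \<in> hom (slice C b) y z"
  proof -
    note f = that(1)[unfolded slice_hom_iff] and g = that(2)[unfolded slice_hom_iff]
    have f': "und f \<in> hom C (Dom C x) (Dom C y)" and g': "und g \<in> hom C (Dom C y) (Dom C z)"
      using f g by auto
    have "Comp C z (Comp C (und g) (und f)) = x"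
      using comp_assoc[OF f' g', of z "Cod C z"] f g by (simp add: hom_iff[of z])
    then show ?thesis
      using comp_hom[OF f' g'] f g unfolding slice_hom_iff by simp
  qed
  show "Comp (slice C b) f (Ident (slice C b) x) = f" if "f \<in> hom (slice C b) x y"
    using that comp_ident_right unfolding slice_hom_iff by (auto intro: arrow.expand)
  show "Comp (slice C b) (Ident (slice C b) y) f = f" if "f \<in> hom (slice C b) x y"
    using that comp_ident_left unfolding slice_hom_iff by (auto intro: arrow.expand)
  show "Comp (slice C b) (Comp (slice C b) h g) f = Comp (slice C b) h (Comp (slice C b) g f)"
    if "f \<in> hom (slice C b) w x" "g \<in> hom (slice C b) x y" "h \<in> hom (slice C b) y z"
    using that comp_assoc[of "und f" "Dom C w" "Dom C x" "und g" "Dom C y" "und h" "Dom C z"]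
    unfolding slice_hom_iff by simp
qed

lemma em_simps [simp]:
  "Obj (em_category C T u m) = em_algebras C T u m"
  "Ident (em_category C T u m) A = Arrow A (Ident C (fst A)) A"
  "Comp (em_category C T u m) k h = Arrow (src h) (Comp C (und k) (und h)) (tgt k)"
  by (auto simp: em_category_def split: prod.splits)

lemma em_hom_iff:
  "k \<in> hom (em_category C T u m) A B \<longleftrightarrow>
     A \<in> em_algebras C T u m \<and> B \<in> em_algebras C T u m \<and>
     src k = A \<and> tgt k = B \<and> und k \<in> hom C (fst A) (fst B) \<and>
     Comp C (und k) (snd A) = Comp C (snd B) (on_arr T (und k))"
  by (cases k; cases A; cases B) (auto simp: em_category_def hom_iff)

lemma em_algebra_hom:
  "A \<in> em_algebras C T u m \<Longrightarrow> fst A \<in> Obj C \<and> snd A \<in> hom C (on_obj T (fst A)) (fst A)"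
  by (auto simp: em_algebras_def)

text \<open>Composites of algebra homomorphisms are homomorphisms by pasting their squares, using
  functoriality of \<open>T\<close>.\<close>

lemma em_category:
  assumes "functor_between C C T"
  shows "category (em_category C T u m)"
proof -
  interpret T: functor_between C C T by fact
  let ?M = "em_category C T u m"
  have arr: "f \<in> hom ?M (Dom ?M f) (Cod ?M f)" if "f \<in> Arr ?M" for f
    using that by (simp add: hom_iff)
  show ?thesis
  proof
    fix x y z f g h w
    show "Dom ?M f \<in> Obj ?M" if "f \<in> Arr ?M"
      using arr[OF that] unfolding em_hom_iff by simp
    show "Cod ?M f \<in> Obj ?M" if "f \<in> Arr ?M"
      using arr[OF that] unfolding em_hom_iff by simp
    show "Ident ?M x \<in> hom ?M x x" if "x \<in> Obj ?M"
      using that em_algebra_hom[of x C T u m] T.C.ident_hom[of "fst x"] T.arr_ident[of "fst x"]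
        T.C.comp_ident_left[of "snd x" "on_obj T (fst x)"] T.C.comp_ident_right[of "snd x" _ "fst x"]
      unfolding em_hom_iff by simp
    show "Comp ?M g f \<in> hom ?M x z" if "f \<in> hom ?M x y" "g \<in> hom ?M y z"
    proof -
      note f = that(1)[unfolded em_hom_iff] and g = that(2)[unfolded em_hom_iff]
      let ?f = "und f" and ?g = "und g"
      have f1: "?f \<in> hom C (fst x) (fst y)" and g1: "?g \<in> hom C (fst y) (fst z)"
        using f g by auto
      have a: "snd x \<in> hom C (on_obj T (fst x)) (fst x)" "snd y \<in> hom C (on_obj T (fst y)) (fst y)"
          "snd z \<in> hom C (on_obj T (fst z)) (fst z)"
        using em_algebra_hom f g by blast+
      have "Comp C (Comp C ?g ?f) (snd x) = Comp C (Comp C ?g (snd y)) (on_arr T ?f)"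
        using T.C.comp_assoc[OF a(1) f1 g1] T.C.comp_assoc[OF T.arr_hom[OF f1] a(2) g1] f by simp
      also have "\<dots> = Comp C (snd z) (on_arr T (Comp C ?g ?f))"
        using T.C.comp_assoc[OF T.arr_hom[OF f1] T.arr_hom[OF g1] a(3)] T.arr_comp[OF f1 g1] g by simp
      finally show ?thesis
        unfolding em_hom_iff using f g T.C.comp_hom[OF f1 g1] by simp
    qed
    show "Comp ?M f (Ident ?M x) = f" if "f \<in> hom ?M x y"
      using that T.C.comp_ident_right unfolding em_hom_iff by (auto intro: arrow.expand)
    show "Comp ?M (Ident ?M y) f = f" if "f \<in> hom ?M x y"
      using that T.C.comp_ident_left unfolding em_hom_iff by (auto intro: arrow.expand)
    show "Comp ?M (Comp ?M h g) f = Comp ?M h (Comp ?M g f)"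
      if "f \<in> hom ?M w x" "g \<in> hom ?M x y" "h \<in> hom ?M y z"
      using that T.C.comp_assoc[of "und f" "fst w" "fst x" "und g" "fst y" "und h" "fst z"]
      unfolding em_hom_iff by simp
  qed
qed

text \<open>An inverse in the base category of an algebra homomorphism is automatically a
  homomorphism, so isomorphisms of algebras can be recognised on underlying arrows.\<close>

lemma em_iso_inI:
  assumes T: "functor_between C C T"
    and k: "k \<in> hom (em_category C T u m) A B"
    and h: "h \<in> hom C (fst B) (fst A)"
    and inv: "Comp C h (und k) = Ident C (fst A)" "Comp C (und k) h = Ident C (fst B)"
  shows "iso_in (em_category C T u m) k"
proof -
  interpret T: functor_between C C T by fact
  interpret M: category "em_category C T u m" by (rule em_category[OF T])
  note k' = k[unfolded em_hom_iff]
  have a: "snd A \<in> hom C (on_obj T (fst A)) (fst A)" "snd B \<in> hom C (on_obj T (fst B)) (fst B)"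
    and obj: "fst A \<in> Obj C" "fst B \<in> Obj C"
    using k' by (auto simp: em_algebras_def)
  have k1: "und k \<in> hom C (fst A) (fst B)" using k' by simp
  \<comment> \<open>Insert the image under \<open>T\<close> of the identity \<open>und k\<close>
    after \<open>h\<close>, apply the homomorphism square of \<open>und k\<close>, and cancel
    \<open>h\<close> against \<open>und k\<close>.\<close>
  have "Comp C h (snd B) = Comp C h (Comp C (snd B) (on_arr T (Comp C (und k) h)))"
    using T.C.comp_ident_right[OF a(2)] inv T.arr_ident obj by simp
  also have "\<dots> = Comp C h (Comp C (Comp C (und k) (snd A)) (on_arr T h))"
    using T.arr_comp[OF h k1] T.C.comp_assoc[OF T.arr_hom[OF h] T.arr_hom[OF k1] a(2)] k' by simp
  also have "\<dots> = Comp C (Comp C h (und k)) (Comp C (snd A) (on_arr T h))"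
    using T.C.comp_assoc[OF T.arr_hom[OF h] a(1) k1]
      T.C.comp_assoc[OF T.C.comp_hom[OF T.arr_hom[OF h] a(1)] k1 h] by simp
  also have "\<dots> = Comp C (snd A) (on_arr T h)"
    using inv T.C.comp_ident_left[OF T.C.comp_hom[OF T.arr_hom[OF h] a(1)]] by simp
  finally have "Arrow B h A \<in> hom (em_category C T u m) B A"
    using k' h unfolding em_hom_iff by simp
  then show ?thesis
    by (rule M.iso_inI[OF k]) (use inv k' in auto)
qed

section \<open>The comparison functor of an adjunction\<close>

context adjunction
begin

lemma functor_monad: "functor_between C C (R \<circ>\<^sub>F L)"
  using functor_comp L.functor_between_axioms R.functor_between_axioms by blast

text \<open>The unit law is the second triangle identity; the associativity law is naturality of the
  counit at its own component \<open>c y\<close>, transported by \<open>R\<close>.\<close>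

lemma comparison_obj:
  assumes y: "y \<in> Obj D"
  shows "(on_obj R y, on_arr R (c y)) \<in> em_algebras C (R \<circ>\<^sub>F L) u (\<lambda>x. on_arr R (c (on_obj L x)))"
proof -
  have c: "c z \<in> hom D (on_obj L (on_obj R z)) z" if "z \<in> Obj D" for z
    using counit.component[OF that] by (simp add: id_functor_def comp_functor_def)
  have LRy: "on_obj L (on_obj R y) \<in> Obj D" by (simp add: L.obj_obj R.obj_obj y)
  have "Comp D (c y) (on_arr L (on_arr R (c y))) = Comp D (c y) (c (on_obj L (on_obj R y)))"
    using counit.naturality[OF c[OF y]] by (simp add: id_functor_def comp_functor_def)
  then have "Comp C (on_arr R (c y)) (on_arr R (on_arr L (on_arr R (c y))))
      = Comp C (on_arr R (c y)) (on_arr R (c (on_obj L (on_obj R y))))"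
    using R.arr_comp[OF L.arr_hom[OF R.arr_hom[OF c[OF y]]] c[OF y]]
      R.arr_comp[OF c[OF LRy] c[OF y]] by simp
  then show ?thesis
    using R.obj_obj[OF y] R.arr_hom[OF c[OF y]] triangle_R[OF y]
    by (simp add: em_algebras_def comp_functor_def)
qed

lemma comparison_functor:
  "functor_between D (em_category C (R \<circ>\<^sub>F L) u (\<lambda>x. on_arr R (c (on_obj L x))))
     (comparison_functor D R c)"
proof -
  let ?M = "em_category C (R \<circ>\<^sub>F L) u (\<lambda>x. on_arr R (c (on_obj L x)))"
  let ?K = "comparison_functor D R c"
  interpret M: category ?M by (rule em_category[OF functor_monad])
  have c: "c z \<in> hom D (on_obj L (on_obj R z)) z" if "z \<in> Obj D" for z
    using counit.component[OF that] by (simp add: id_functor_def comp_functor_def)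
  show ?thesis
  proof
    show "on_obj ?K x \<in> Obj ?M" if "x \<in> Obj D" for x
      using comparison_obj[OF that] by (simp add: comparison_functor_def)
    show "on_arr ?K f \<in> hom ?M (on_obj ?K x) (on_obj ?K y)" if f: "f \<in> hom D x y" for f x y
    proof -
      have o: "x \<in> Obj D" "y \<in> Obj D" using L.D.hom_obj[OF f] by auto
      have "Comp D f (c x) = Comp D (c y) (on_arr L (on_arr R f))"
        using counit.naturality[OF f] by (simp add: id_functor_def comp_functor_def)
      then have "Comp C (on_arr R f) (on_arr R (c x))
          = Comp C (on_arr R (c y)) (on_arr R (on_arr L (on_arr R f)))"
        using R.arr_comp[OF c[OF o(1)] f] R.arr_comp[OF L.arr_hom[OF R.arr_hom[OF f]] c[OF o(2)]]
        by simp
      then show ?thesis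
        unfolding em_hom_iff using comparison_obj o f R.arr_hom[OF f]
        by (auto simp: comparison_functor_def comp_functor_def hom_iff)
    qed
    show "on_arr ?K (Ident D x) = Ident ?M (on_obj ?K x)" if "x \<in> Obj D" for x
      using L.D.ident_hom[OF that] R.arr_ident[OF that]
      by (simp add: comparison_functor_def hom_iff)
    show "on_arr ?K (Comp D g f) = Comp ?M (on_arr ?K g) (on_arr ?K f)"
      if "f \<in> hom D x y" "g \<in> hom D y z" for f g x y z
      using that L.D.comp_hom[OF that] R.arr_comp[OF that]
      by (simp add: comparison_functor_def hom_iff)
  qed
qed

end

section \<open>Preordered sets and their slices\<close>

lemma PreOrd_simps [simp]:
  "Obj (PreOrd small) = {X. small (fst X) \<and> preordered_set X}"
  "Dom (PreOrd small) = src"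
  "Cod (PreOrd small) = tgt"
  "Ident (PreOrd small) X = Arrow X (\<lambda>x\<in>fst X. x) X"
  "Comp (PreOrd small) = comp_map"
  by (simp_all add: PreOrd_def)

lemma PreOrd_Arr_iff:
  "f \<in> Arr (PreOrd small) \<longleftrightarrow> small (fst (src f)) \<and> small (fst (tgt f)) \<and> monotone_map f"
  by (simp add: PreOrd_def)

lemma comp_map_simps [simp]:
  "src (comp_map g f) = src f"
  "tgt (comp_map g f) = tgt g"
  "x \<in> fst (src f) \<Longrightarrow> und (comp_map g f) x = und g (und f x)"
  by (simp_all add: comp_map_def compose_def)

context
  fixes X :: "'a preset"
  assumes X: "preordered_set X"
begin

lemma preordered_set_refl: "x \<in> fst X \<Longrightarrow> (x, x) \<in> snd X"
  using X by (simp add: preordered_set_def preorder_on_def refl_on_def)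

lemma preordered_set_trans: "\<lbrakk>(x, y) \<in> snd X; (y, z) \<in> snd X\<rbrakk> \<Longrightarrow> (x, z) \<in> snd X"
  using X unfolding preordered_set_def preorder_on_def by (meson transD)

lemma preordered_set_carrier: "(x, y) \<in> snd X \<Longrightarrow> x \<in> fst X \<and> y \<in> fst X"
  using X by (auto simp: preordered_set_def preorder_on_def)

end

lemma preordered_setI:
  assumes "\<And>x y. (x, y) \<in> snd X \<Longrightarrow> x \<in> fst X \<and> y \<in> fst X"
    and "\<And>x. x \<in> fst X \<Longrightarrow> (x, x) \<in> snd X"
    and "\<And>x y z. \<lbrakk>(x, y) \<in> snd X; (y, z) \<in> snd X\<rbrakk> \<Longrightarrow> (x, z) \<in> snd X"
  shows "preordered_set X"
  using assms unfolding preordered_set_def preorder_on_def refl_on_def trans_def by force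

lemma monotone_mapD:
  assumes "monotone_map f"
  shows "preordered_set (src f)" "preordered_set (tgt f)"
    "x \<in> fst (src f) \<Longrightarrow> und f x \<in> fst (tgt f)"
    "(x, y) \<in> snd (src f) \<Longrightarrow> (und f x, und f y) \<in> snd (tgt f)"
  using assms by (auto simp: monotone_map_def)

lemma monotone_map_comp:
  assumes "monotone_map f" "monotone_map g" "tgt f = src g"
  shows "monotone_map (comp_map g f)"
proof -
  have "und (comp_map g f) x = und g (und f x) \<and> und (comp_map g f) y = und g (und f y)"
    if "(x, y) \<in> snd (src f)" for x y
    using that preordered_set_carrier[OF monotone_mapD(1)[OF assms(1)]] by auto
  then show ?thesis
    using assms unfolding monotone_map_def
    by (auto simp: compose_def comp_map_def restrict_def)
qed

lemma comp_map_assoc: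
  assumes "monotone_map f" "tgt f = src g"
  shows "comp_map (comp_map h g) f = comp_map h (comp_map g f)"
  using assms by (auto simp: comp_map_def monotone_map_def compose_def restrict_def fun_eq_iff)

lemma monotone_map_eqI:
  assumes "monotone_map f" "monotone_map g" "src f = src g" "tgt f = tgt g"
    and "\<And>x. x \<in> fst (src f) \<Longrightarrow> und f x = und g x"
  shows "f = g"
proof (rule arrow.expand)
  have "und f \<in> extensional (fst (src f))" "und g \<in> extensional (fst (src f))"
    using assms by (auto simp: monotone_map_def PiE_def)
  then have "und f = und g" using assms(5) by (rule extensionalityI)
  then show "src f = src g \<and> und f = und g \<and> tgt f = tgt g" using assms by simp
qed

lemma monotone_map_ident: "preordered_set X \<Longrightarrow> monotone_map (Arrow X (\<lambda>x\<in>fst X. x) X)"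
  by (auto simp: monotone_map_def dest: preordered_set_carrier)

lemma PreOrd_category: "category (PreOrd small)"
proof
  show "Comp (PreOrd small) g f \<in> hom (PreOrd small) x z"
    if "f \<in> hom (PreOrd small) x y" "g \<in> hom (PreOrd small) y z" for f g x y z
    using that monotone_map_comp[of f g] by (auto simp: hom_iff PreOrd_Arr_iff)
  show "Comp (PreOrd small) f (Ident (PreOrd small) x) = f"
    if f: "f \<in> hom (PreOrd small) x y" for f x y
    using f monotone_mapD[of f] by (intro monotone_map_eqI)
      (auto simp: hom_iff PreOrd_Arr_iff intro!: monotone_map_ident monotone_map_comp)
  show "Comp (PreOrd small) (Ident (PreOrd small) y) f = f"
    if f: "f \<in> hom (PreOrd small) x y" for f x y
    using f monotone_mapD[of f] by (intro monotone_map_eqI)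
      (auto simp: hom_iff PreOrd_Arr_iff intro!: monotone_map_ident monotone_map_comp)
qed (auto simp: hom_iff PreOrd_Arr_iff comp_map_assoc monotone_map_ident dest: monotone_mapD)

lemma PreOrd_slice_category: "category (slice (PreOrd small) b)"
  by (rule category.slice_category[OF PreOrd_category])

text \<open>This form reduces arrows over a base to conditions on elements; with extensionality,
  equations between composites in a slice then become pointwise computations.\<close>

lemma PreOrd_slice_hom_iff:
  "k \<in> hom (slice (PreOrd small) b) g g' \<longleftrightarrow>
     g \<in> Arr (PreOrd small) \<and> tgt g = b \<and> g' \<in> Arr (PreOrd small) \<and> tgt g' = b \<and>
     src k = g \<and> tgt k = g' \<and> src (und k) = src g \<and> tgt (und k) = src g' \<and>
     und (und k) \<in> extensional (fst (src g)) \<and>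
     (\<forall>x \<in> fst (src g). und (und k) x \<in> fst (src g')) \<and>
     (\<forall>x y. (x, y) \<in> snd (src g) \<longrightarrow> (und (und k) x, und (und k) y) \<in> snd (src g')) \<and>
     (\<forall>x \<in> fst (src g). und g' (und (und k) x) = und g x)"
  (is "?L \<longleftrightarrow> ?R")
proof
  assume ?L
  then have "monotone_map (und k)" "und (comp_map g' (und k)) = und g"
    "g \<in> Arr (PreOrd small) \<and> tgt g = b \<and> g' \<in> Arr (PreOrd small) \<and> tgt g' = b \<and>
     src k = g \<and> tgt k = g' \<and> src (und k) = src g \<and> tgt (und k) = src g'"
    unfolding slice_hom_iff by (auto simp: hom_iff PreOrd_Arr_iff)
  then show ?R
    using comp_map_simps(3)[of _ "und k" g'] unfolding monotone_map_def by (auto simp: PiE_iff)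
next
  assume R: ?R
  then have k: "monotone_map (und k)" by (auto simp: monotone_map_def PreOrd_Arr_iff PiE_iff)
  have "comp_map g' (und k) = g"
    using R k by (intro monotone_map_eqI monotone_map_comp) (auto simp: PreOrd_Arr_iff)
  then show ?L
    using R k unfolding slice_hom_iff by (auto simp: hom_iff PreOrd_Arr_iff)
qed

lemma PreOrd_slice_eqI:
  assumes "k \<in> hom (slice (PreOrd small) b) g g'" "k' \<in> hom (slice (PreOrd small) b) g g'"
    and "\<And>x. x \<in> fst (src g) \<Longrightarrow> und (und k) x = und (und k') x"
  shows "k = k'"
proof -
  note k = assms(1)[unfolded PreOrd_slice_hom_iff] and k' = assms(2)[unfolded PreOrd_slice_hom_iff]
  have "und k = und k'"
    by (rule monotone_map_eqI) (use k k' assms(3) in \<open>auto simp: monotone_map_def PreOrd_Arr_iff PiE_iff\<close>)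
  then show ?thesis using k k' by (auto intro: arrow.expand)
qed

section \<open>Fibre products and change of base\<close>

context set_universe
begin

text \<open>An infinite type is equipotent to its square, so the choice made in
  \<open>pair_code\<close> does select an injection.\<close>

lemma inj_pair_code:
  includes cardinal_syntax
  shows "inj (pair_code :: 'u \<times> 'u \<Rightarrow> 'u)"
proof -
  have "|UNIV \<times> UNIV :: ('u \<times> 'u) set| =o |UNIV :: 'u set|"
    using card_of_Times_same_infinite[OF infinite_univ] .
  then obtain h :: "'u \<times> 'u \<Rightarrow> 'u" where "bij_betw h (UNIV \<times> UNIV) UNIV"
    using card_of_ordIso by blast
  then have "inj h" by (simp add: bij_betw_def)
  then have "inj (SOME h :: 'u \<times> 'u \<Rightarrow> 'u. inj h)" by (rule someI[of inj])
  then show ?thesis by (simp add: pair_code_def)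
qed

lemma code_pair [simp]: "inv (pair_code :: 'u \<times> 'u \<Rightarrow> 'u) (pair_code z) = z"
  using inj_pair_code by simp

lemma pair_code_eq_iff [simp]: "pair_code z = (pair_code w :: 'u) \<longleftrightarrow> z = w"
  using inj_pair_code by (simp add: inj_eq)

lemma fibre_product_mem [simp]:
  fixes p f :: "('u, 'u) monotone_map"
  shows "pair_code (e, a) \<in> fst (fibre_product p f) \<longleftrightarrow>
    e \<in> fst (src p) \<and> a \<in> fst (src f) \<and> und p e = und f a"
  by (auto simp: fibre_product_def image_iff)

lemma fibre_product_rel [simp]:
  fixes p f :: "('u, 'u) monotone_map"
  shows "(pair_code (e, a), pair_code (e', a')) \<in> snd (fibre_product p f) \<longleftrightarrow>
    und p e = und f a \<and> und p e' = und f a' \<and> (e, e') \<in> snd (src p) \<and> (a, a') \<in> snd (src f)"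
  by (auto simp: fibre_product_def)

lemma fibre_productE:
  fixes p f :: "('u, 'u) monotone_map"
  assumes "z \<in> fst (fibre_product p f)"
  obtains e a where "z = pair_code (e, a)" "e \<in> fst (src p)" "a \<in> fst (src f)" "und p e = und f a"
  using assms by (auto simp: fibre_product_def)

lemma fibre_product_relE:
  fixes p f :: "('u, 'u) monotone_map"
  assumes "(z, z') \<in> snd (fibre_product p f)"
  obtains e a e' a' where "z = pair_code (e, a)" "z' = pair_code (e', a')"
    "und p e = und f a" "und p e' = und f a'" "(e, e') \<in> snd (src p)" "(a, a') \<in> snd (src f)"
  using assms by (auto simp: fibre_product_def)

lemma pullback_proj1_simps [simp]:
  "src (pullback_proj1 p f) = fibre_product p f"
  "tgt (pullback_proj1 p f) = src p"
  by (simp_all add: pullback_proj1_def)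

lemma pullback_proj1_pair [simp]:
  fixes p f :: "('u, 'u) monotone_map"
  shows "pair_code (e, a) \<in> fst (fibre_product p f) \<Longrightarrow> und (pullback_proj1 p f) (pair_code (e, a)) = e"
  by (simp add: pullback_proj1_def)

text \<open>The carrier is contained in a union, indexed by the small set of all \<open>e\<close>,
  of images of the carrier of \<open>src f\<close>.\<close>

lemma small_fibre_product:
  fixes p f :: "('u, 'u) monotone_map"
  assumes "small (fst (src p))" "small (fst (src f))"
  shows "small (fst (fibre_product p f))"
proof -
  have "small (\<Union>e\<in>fst (src p). (\<lambda>a. pair_code (e, a)) ` fst (src f))"
    using assms by (intro small_UN small_image)
  then show ?thesis
    by (rule small_subset) (auto elim!: fibre_productE)
qed

lemma preordered_fibre_product:
  fixes p f :: "('u, 'u) monotone_map"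
  assumes "preordered_set (src p)" "preordered_set (src f)"
  shows "preordered_set (fibre_product p f)"
proof (rule preordered_setI)
  show "(x, z) \<in> snd (fibre_product p f)"
    if "(x, y) \<in> snd (fibre_product p f)" "(y, z) \<in> snd (fibre_product p f)" for x y z
    using that by (auto elim!: fibre_product_relE intro: preordered_set_trans[OF assms(1)]
        preordered_set_trans[OF assms(2)])
qed (auto elim!: fibre_product_relE fibre_productE
    dest: preordered_set_carrier[OF assms(1)] preordered_set_carrier[OF assms(2)]
    intro: preordered_set_refl[OF assms(1)] preordered_set_refl[OF assms(2)])

lemma pullback_proj1_Arr:
  fixes p f :: "('u, 'u) monotone_map"
  assumes "p \<in> Arr (PreOrd small)" "f \<in> Arr (PreOrd small)"
  shows "pullback_proj1 p f \<in> Arr (PreOrd small)"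
proof -
  have pre: "preordered_set (src p)" "preordered_set (src f)" "preordered_set (fibre_product p f)"
    using assms monotone_mapD(1) by (auto simp: PreOrd_Arr_iff intro!: preordered_fibre_product)
  have "monotone_map (pullback_proj1 p f)"
    unfolding monotone_map_def using pre
    by (auto simp: pullback_proj1_def elim!: fibre_productE fibre_product_relE
        dest: preordered_set_carrier)
  then show ?thesis
    using assms small_fibre_product by (auto simp: PreOrd_Arr_iff)
qed

end

section \<open>The adjunction between postcomposition and pullback along \<open>p\<close>\<close>

lemma comp_functor_simps [simp]:
  "on_obj (G \<circ>\<^sub>F F) x = on_obj G (on_obj F x)"
  "on_arr (G \<circ>\<^sub>F F) f = on_arr G (on_arr F f)"
  "on_obj id_functor x = x"
  "on_arr id_functor f = f"
  by (simp_all add: comp_functor_def id_functor_def)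

text \<open>The left adjoint of the pullback functor; on arrows only the recorded source and target
  change, while the underlying monotone map stays the same.\<close>

definition postcomposition ::
  "('u, 'u) monotone_map \<Rightarrow>
    (('u, 'u) monotone_map,
     (('u, 'u) monotone_map, ('u, 'u) monotone_map, ('u, 'u) monotone_map) arrow,
     ('u, 'u) monotone_map,
     (('u, 'u) monotone_map, ('u, 'u) monotone_map, ('u, 'u) monotone_map) arrow) fun_data" where
  "postcomposition p =
     \<lparr>on_obj = comp_map p,
      on_arr = (\<lambda>h. Arrow (comp_map p (src h)) (und h) (comp_map p (tgt h)))\<rparr>"

definition base_change_unit ::
  "('u, 'u) monotone_map \<Rightarrow> ('u, 'u) monotone_map \<Rightarrow>
    (('u, 'u) monotone_map, ('u, 'u) monotone_map, ('u, 'u) monotone_map) arrow" where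
  "base_change_unit p x = Arrow x
     (Arrow (src x) (\<lambda>z \<in> fst (src x). pair_code (und x z, z)) (fibre_product p (comp_map p x)))
     (pullback_proj1 p (comp_map p x))"

definition base_change_counit ::
  "('u, 'u) monotone_map \<Rightarrow> ('u, 'u) monotone_map \<Rightarrow>
    (('u, 'u) monotone_map, ('u, 'u) monotone_map, ('u, 'u) monotone_map) arrow" where
  "base_change_counit p y = Arrow (comp_map p (pullback_proj1 p y))
     (Arrow (fibre_product p y) (\<lambda>z \<in> fst (fibre_product p y). code_snd z) (src y)) y"

locale base_change = set_universe small for small :: "'u set \<Rightarrow> bool" +
  fixes p :: "('u, 'u) monotone_map"
  assumes p_Arr: "p \<in> Arr (PreOrd small)"
begin

abbreviation SB where "SB \<equiv> slice (PreOrd small) (tgt p)"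
abbreviation SE where "SE \<equiv> slice (PreOrd small) (src p)"
abbreviation R where "R \<equiv> pullback_functor p"
abbreviation L where "L \<equiv> postcomposition p"

lemma p_mono: "monotone_map p"
  using p_Arr by (simp add: PreOrd_Arr_iff)

lemma R_simps [simp]:
  "on_obj R = pullback_proj1 p"
  "src (on_arr R h) = pullback_proj1 p (src h)"
  "tgt (on_arr R h) = pullback_proj1 p (tgt h)"
  "src (und (on_arr R h)) = fibre_product p (src h)"
  "tgt (und (on_arr R h)) = fibre_product p (tgt h)"
  "pair_code (e, a) \<in> fst (fibre_product p (src h)) \<Longrightarrow>
     und (und (on_arr R h)) (pair_code (e, a)) = pair_code (e, und (und h) a)"
  by (simp_all add: pullback_functor_def)

lemma L_simps [simp]:
  "on_obj L = comp_map p"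
  "src (on_arr L h) = comp_map p (src h)"
  "tgt (on_arr L h) = comp_map p (tgt h)"
  "und (on_arr L h) = und h"
  by (simp_all add: postcomposition_def)

text \<open>The relation of a fibre product is defined without mention of the carriers; membership
  comes from the preorders on \<open>src p\<close> and \<open>src y\<close>.\<close>

lemma fibre_product_relE':
  assumes "(z, z') \<in> snd (fibre_product p y)" "y \<in> Arr (PreOrd small)"
  obtains e a e' a' where "z = pair_code (e, a)" "z' = pair_code (e', a')"
    "und p e = und y a" "und p e' = und y a'" "(e, e') \<in> snd (src p)" "(a, a') \<in> snd (src y)"
    "e \<in> fst (src p)" "e' \<in> fst (src p)" "a \<in> fst (src y)" "a' \<in> fst (src y)"
proof -
  have "preordered_set (src p)" "preordered_set (src y)"
    using p_mono assms(2) monotone_mapD(1) by (auto simp: PreOrd_Arr_iff)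
  then show thesis
    using fibre_product_relE[OF assms(1)] preordered_set_carrier that by metis
qed

lemma R_hom:
  assumes "h \<in> hom SB y y'"
  shows "on_arr R h \<in> hom SE (pullback_proj1 p y) (pullback_proj1 p y')"
proof -
  note h = assms[unfolded PreOrd_slice_hom_iff]
  have ext: "und (und (on_arr R h)) \<in> extensional (fst (fibre_product p y))"
    using h by (simp add: pullback_functor_def)
  show ?thesis
    unfolding PreOrd_slice_hom_iff using h ext p_Arr
    by (auto simp: pullback_proj1_Arr
        elim!: fibre_productE fibre_product_relE')
qed

lemma R_functor: "functor_between SB SE R"
proof (intro functor_between.intro functor_between_axioms.intro PreOrd_slice_category)
  interpret SB: category SB by (rule PreOrd_slice_category)
  interpret SE: category SE by (rule PreOrd_slice_category)
  show "on_obj R y \<in> Obj SE" if "y \<in> Obj SB" for y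
    using that pullback_proj1_Arr[OF p_Arr] by simp
  show R: "on_arr R h \<in> hom SE (on_obj R y) (on_obj R y')" if "h \<in> hom SB y y'" for h y y'
    using R_hom[OF that] by simp
  show "on_arr R (Ident SB y) = Ident SE (on_obj R y)" if "y \<in> Obj SB" for y
    using that pullback_proj1_Arr[OF p_Arr, of y]
    by (intro PreOrd_slice_eqI[OF R[OF SB.ident_hom] SE.ident_hom])
      (auto elim!: fibre_productE)
  show "on_arr R (Comp SB g f) = Comp SE (on_arr R g) (on_arr R f)"
    if f: "f \<in> hom SB x y" and g: "g \<in> hom SB y z" for f g x y z
    using f[unfolded PreOrd_slice_hom_iff] g[unfolded PreOrd_slice_hom_iff]
    by (intro PreOrd_slice_eqI[OF R[OF SB.comp_hom[OF f g]] SE.comp_hom[OF R[OF f] R[OF g]]])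
      (auto elim!: fibre_productE)
qed

lemma comp_p_Arr:
  "\<lbrakk>x \<in> Arr (PreOrd small); tgt x = src p\<rbrakk> \<Longrightarrow> comp_map p x \<in> Arr (PreOrd small)"
  using p_Arr monotone_map_comp by (auto simp: PreOrd_Arr_iff)

lemma comp_p_und:
  "\<lbrakk>x \<in> Arr (PreOrd small); tgt x = src p; z \<in> fst (src x)\<rbrakk>
    \<Longrightarrow> und x z \<in> fst (src p) \<and> und (comp_map p x) z = und p (und x z)"
  using monotone_mapD(3)[of x z] by (simp add: PreOrd_Arr_iff)

lemma L_hom:
  assumes "h \<in> hom SE x x'"
  shows "on_arr L h \<in> hom SB (comp_map p x) (comp_map p x')"
  using assms comp_p_Arr[of x] comp_p_Arr[of x']
  unfolding PreOrd_slice_hom_iff by (auto simp: comp_p_und)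

lemma L_functor: "functor_between SE SB L"
proof (intro functor_between.intro functor_between_axioms.intro PreOrd_slice_category)
  show "on_obj L x \<in> Obj SB" if "x \<in> Obj SE" for x
    using that comp_p_Arr[of x] by simp
qed (simp_all add: L_hom, simp_all add: postcomposition_def)

lemma unit_hom:
  assumes "x \<in> Arr (PreOrd small)" "tgt x = src p"
  shows "base_change_unit p x \<in> hom SE x (pullback_proj1 p (comp_map p x))"
proof -
  have x: "monotone_map x" using assms by (simp add: PreOrd_Arr_iff)
  show ?thesis
    unfolding PreOrd_slice_hom_iff
    using assms(2) pullback_proj1_Arr[OF p_Arr comp_p_Arr[OF assms]] monotone_mapD[OF x]
      preordered_set_carrier[OF monotone_mapD(1)[OF x]] assms(1)
    by (auto simp: base_change_unit_def)
qed

lemma counit_hom: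
  assumes "y \<in> Arr (PreOrd small)" "tgt y = tgt p"
  shows "base_change_counit p y \<in> hom SB (comp_map p (pullback_proj1 p y)) y"
proof -
  note P = comp_p_Arr[OF pullback_proj1_Arr[OF p_Arr assms(1)]]
  show ?thesis
    unfolding PreOrd_slice_hom_iff
    using assms P
    by (auto simp: base_change_counit_def elim!: fibre_productE fibre_product_relE')
qed

lemma unit_simps [simp]:
  "src (base_change_unit p x) = x"
  "tgt (base_change_unit p x) = pullback_proj1 p (comp_map p x)"
  "src (und (base_change_unit p x)) = src x"
  "tgt (und (base_change_unit p x)) = fibre_product p (comp_map p x)"
  "z \<in> fst (src x) \<Longrightarrow> und (und (base_change_unit p x)) z = pair_code (und x z, z)"
  by (simp_all add: base_change_unit_def)

lemma counit_simps [simp]: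
  "src (base_change_counit p y) = comp_map p (pullback_proj1 p y)"
  "tgt (base_change_counit p y) = y"
  "src (und (base_change_counit p y)) = fibre_product p y"
  "tgt (und (base_change_counit p y)) = src y"
  "pair_code (e, a) \<in> fst (fibre_product p y) \<Longrightarrow>
     und (und (base_change_counit p y)) (pair_code (e, a)) = a"
  by (simp_all add: base_change_counit_def)

text \<open>The unit is \<open>z\<close> to \<open>(x z, z)\<close> and the counit is the second
  projection, so naturality and both triangle identities can be read off on elements.\<close>

lemma base_change_adjunction:
  "adjunction SE SB L R (base_change_unit p) (base_change_counit p)"
proof -
  interpret L: functor_between SE SB L by (rule L_functor)
  interpret R: functor_between SB SE R by (rule R_functor)
  have unit: "nat_trans SE SE id_functor (R \<circ>\<^sub>F L) (base_change_unit p)"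
  proof (rule nat_trans.intro[OF L.C.functor_id functor_comp[OF L_functor R_functor]], unfold_locales)
    show "base_change_unit p x \<in> hom SE (on_obj id_functor x) (on_obj (R \<circ>\<^sub>F L) x)"
      if "x \<in> Obj SE" for x
      using that unit_hom by simp
    show "Comp SE (base_change_unit p y) (on_arr id_functor f)
        = Comp SE (on_arr (R \<circ>\<^sub>F L) f) (base_change_unit p x)"
      if f: "f \<in> hom SE x y" for f x y
    proof -
      note f' = f[unfolded PreOrd_slice_hom_iff]
      have m: "base_change_unit p x \<in> hom SE x (pullback_proj1 p (comp_map p x))"
        "base_change_unit p y \<in> hom SE y (pullback_proj1 p (comp_map p y))"
        using f' unit_hom by auto
      have "\<And>z. z \<in> fst (src x) \<Longrightarrow> und x z \<in> fst (src p) \<and> und (und f) z \<in> fst (src y)"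
        using f' monotone_mapD(3)[of x] by (auto simp: PreOrd_Arr_iff)
      then show ?thesis
        unfolding comp_functor_simps using f'
        by (intro PreOrd_slice_eqI[OF L.C.comp_hom[OF f m(2)]
              L.C.comp_hom[OF m(1) R_hom[OF L_hom[OF f]]]]) auto
    qed
  qed
  have counit: "nat_trans SB SB (L \<circ>\<^sub>F R) id_functor (base_change_counit p)"
  proof (rule nat_trans.intro[OF functor_comp[OF R_functor L_functor] L.D.functor_id], unfold_locales)
    show "base_change_counit p y \<in> hom SB (on_obj (L \<circ>\<^sub>F R) y) (on_obj id_functor y)"
      if "y \<in> Obj SB" for y
      using that counit_hom by simp
    show "Comp SB (base_change_counit p y) (on_arr (L \<circ>\<^sub>F R) f)
        = Comp SB (on_arr id_functor f) (base_change_counit p x)"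
      if f: "f \<in> hom SB x y" for f x y
    proof -
      note f' = f[unfolded PreOrd_slice_hom_iff]
      have m: "base_change_counit p x \<in> hom SB (comp_map p (pullback_proj1 p x)) x"
        "base_change_counit p y \<in> hom SB (comp_map p (pullback_proj1 p y)) y"
        using f' counit_hom by auto
      have "\<And>z. z \<in> fst (src x) \<Longrightarrow> und (und f) z \<in> fst (src y)"
        using f' by auto
      then show ?thesis
        unfolding comp_functor_simps using f'
        by (intro PreOrd_slice_eqI[OF L.D.comp_hom[OF L_hom[OF R_hom[OF f]] m(2)]
              L.D.comp_hom[OF m(1) f]]) (auto elim!: fibre_productE)
    qed
  qed
  have "adjunction_axioms SE SB L R (base_change_unit p) (base_change_counit p)"
  proof
    show "Comp SB (base_change_counit p (on_obj L x)) (on_arr L (base_change_unit p x))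
        = Ident SB (on_obj L x)" if "x \<in> Obj SE" for x
    proof -
      have x: "x \<in> Arr (PreOrd small)" "tgt x = src p" using that by auto
      then have "\<And>z. z \<in> fst (src x) \<Longrightarrow> und x z \<in> fst (src p)"
        using monotone_mapD(3)[of x] by (auto simp: PreOrd_Arr_iff)
      then show ?thesis
        unfolding L_simps(1) using comp_p_Arr[OF x] x
        by (intro PreOrd_slice_eqI[OF L.D.comp_hom[OF L_hom[OF unit_hom[OF x]]
              counit_hom[OF comp_p_Arr[OF x]]] L.D.ident_hom]) auto
    qed
    show "Comp SE (on_arr R (base_change_counit p y)) (base_change_unit p (on_obj R y))
        = Ident SE (on_obj R y)" if "y \<in> Obj SB" for y
    proof -
      have y: "y \<in> Arr (PreOrd small)" "tgt y = tgt p" using that by auto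
      note P = pullback_proj1_Arr[OF p_Arr y(1)]
      show ?thesis
        unfolding R_simps(1) using y P
        by (intro PreOrd_slice_eqI[OF L.C.comp_hom[OF unit_hom[OF P]
              R_hom[OF counit_hom[OF y]]] L.C.ident_hom]) (auto elim!: fibre_productE)
    qed
  qed
  then show ?thesis
    by (intro adjunction.intro L_functor R_functor unit counit)
qed

end

section \<open>Descent along maps that lift chains\<close>

text \<open>The classical criterion for effective descent of preordered sets. Degenerate chains also
  yield lifts of pairs and of points, so \<open>p\<close> is surjective.\<close>

locale chain_lifting = base_change small p for small :: "'u set \<Rightarrow> bool" and p +
  assumes lift_chain: "\<lbrakk>(b\<^sub>0, b\<^sub>1) \<in> snd (tgt p); (b\<^sub>1, b\<^sub>2) \<in> snd (tgt p)\<rbrakk> \<Longrightarrow>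
    \<exists>e\<^sub>0 e\<^sub>1 e\<^sub>2. (e\<^sub>0, e\<^sub>1) \<in> snd (src p) \<and> (e\<^sub>1, e\<^sub>2) \<in> snd (src p) \<and>
      und p e\<^sub>0 = b\<^sub>0 \<and> und p e\<^sub>1 = b\<^sub>1 \<and> und p e\<^sub>2 = b\<^sub>2"

section \<open>Algebras of the induced monad as transport maps\<close>

context base_change
begin

interpretation adj: adjunction SE SB L R "base_change_unit p" "base_change_counit p"
  by (rule base_change_adjunction)

abbreviation T where "T \<equiv> R \<circ>\<^sub>F L"
abbreviation algebras where
  "algebras \<equiv> em_algebras SE T (base_change_unit p) (\<lambda>x. on_arr R (base_change_counit p (on_obj L x)))"
abbreviation EM where
  "EM \<equiv> em_category SE T (base_change_unit p) (\<lambda>x. on_arr R (base_change_counit p (on_obj L x)))"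
abbreviation K where "K \<equiv> comparison_functor SB R (base_change_counit p)"

lemma E_preordered: "preordered_set (src p)" and B_preordered: "preordered_set (tgt p)"
  using monotone_mapD p_mono by auto

text \<open>The structure map of an algebra on \<open>x\<close> moves an element \<open>z\<close> into the fibre over \<open>e\<close>.\<close>

definition transport where "transport a e z = und (und a) (pair_code (e, z))"

context
  fixes x a
  assumes algebra: "(x, a) \<in> algebras"
begin

lemma algebra_obj: "x \<in> Arr (PreOrd small)" "tgt x = src p"
  using em_algebra_hom[OF algebra] by auto

lemma algebra_hom: "a \<in> hom SE (pullback_proj1 p (comp_map p x)) x"
  using em_algebra_hom[OF algebra] by simp

lemma algebra_und: "z \<in> fst (src x) \<Longrightarrow> und x z \<in> fst (src p)"
  using comp_p_und[OF algebra_obj] by blast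

text \<open>The structure map is an arrow over \<open>E\<close>, so its value at
  \<open>(e, z)\<close> lies over the first projection \<open>e\<close>.\<close>

lemma transport:
  assumes "e \<in> fst (src p)" "z \<in> fst (src x)" "und p e = und p (und x z)"
  shows "transport a e z \<in> fst (src x)" "und x (transport a e z) = e"
proof -
  have *: "pair_code (e, z) \<in> fst (fibre_product p (comp_map p x))"
    using assms by simp
  then show "transport a e z \<in> fst (src x)"
    using algebra_hom unfolding PreOrd_slice_hom_iff transport_def by auto
  have "und x (transport a e z) = und (pullback_proj1 p (comp_map p x)) (pair_code (e, z))"
    using * algebra_hom unfolding PreOrd_slice_hom_iff transport_def by auto
  then show "und x (transport a e z) = e" using * by simp
qed

lemma transport_mono:
  assumes "(e, e') \<in> snd (src p)" "(z, z') \<in> snd (src x)"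
    "und p e = und p (und x z)" "und p e' = und p (und x z')"
  shows "(transport a e z, transport a e' z') \<in> snd (src x)"
proof -
  have "preordered_set (src x)" using algebra_obj monotone_mapD(1) by (auto simp: PreOrd_Arr_iff)
  then have "(pair_code (e, z), pair_code (e', z')) \<in> snd (fibre_product p (comp_map p x))"
    using assms preordered_set_carrier[of "src x"] by auto
  then show ?thesis
    using algebra_hom unfolding PreOrd_slice_hom_iff transport_def by auto
qed

text \<open>This is the unit law of the algebra evaluated at \<open>z\<close>.\<close>

lemma transport_unit:
  assumes "z \<in> fst (src x)"
  shows "transport a (und x z) z = z"
proof -
  have "Comp SE a (base_change_unit p x) = Ident SE x"
    using algebra by (auto simp: em_algebras_def)
  then have "und (und (Comp SE a (base_change_unit p x))) z = und (und (Ident SE x)) z" by simp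
  then show ?thesis using assms by (simp add: transport_def)
qed

text \<open>This is the associativity law evaluated at \<open>(e, (e', z))\<close>:
  \<open>T a\<close> first moves \<open>z\<close> over \<open>e'\<close>, while the multiplication
  forgets \<open>e'\<close>.\<close>

lemma transport_transport:
  assumes "e \<in> fst (src p)" "e' \<in> fst (src p)" "z \<in> fst (src x)"
    "und p e = und p (und x z)" "und p e' = und p (und x z)"
  shows "transport a e (transport a e' z) = transport a e z"
proof -
  let ?w = "pair_code (e, pair_code (e', z))"
  have a: "src a = pullback_proj1 p (comp_map p x)" "tgt a = x"
    using algebra_hom unfolding PreOrd_slice_hom_iff by auto
  have "Comp SE a (on_arr T a) = Comp SE a (on_arr R (base_change_counit p (on_obj L x)))"
    using algebra by (auto simp: em_algebras_def)
  then have "und (und (Comp SE a (on_arr T a))) ?w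
      = und (und (Comp SE a (on_arr R (base_change_counit p (on_obj L x))))) ?w" by simp
  then show ?thesis using assms a by (simp add: transport_def)
qed

end

lemma comparison_simps [simp]:
  "on_obj K y = (pullback_proj1 p y, on_arr R (base_change_counit p y))"
  "und (on_arr K h) = on_arr R h"
  by (simp_all add: comparison_functor_def)

end

section \<open>Monadicity of the pullback functor from lifting of chains\<close>

context chain_lifting
begin

interpretation adj: adjunction SE SB L R "base_change_unit p" "base_change_counit p"
  by (rule base_change_adjunction)

text \<open>Lift the degenerate chain b \<le> b' \<le> b' and keep its first two points.\<close>

lemma lift_pair:
  assumes "(b, b') \<in> snd (tgt p)"
  obtains e e' where "(e, e') \<in> snd (src p)" "und p e = b" "und p e' = b'"
  using lift_chain[OF assms] preordered_set_refl[OF B_preordered]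
    preordered_set_carrier[OF B_preordered assms] by meson

lemma lift_point:
  assumes "b \<in> fst (tgt p)"
  obtains e where "e \<in> fst (src p)" "und p e = b"
  using lift_pair[OF preordered_set_refl[OF B_preordered assms]]
    preordered_set_carrier[OF E_preordered] by metis

text \<open>A set-theoretic section of \<open>p\<close>, chosen point by point; it need not be
  monotone.\<close>

definition sec where "sec b = (SOME e. e \<in> fst (src p) \<and> und p e = b)"

lemma sec:
  assumes "b \<in> fst (tgt p)"
  shows "sec b \<in> fst (src p)" "und p (sec b) = b"
proof -
  have "\<exists>e. e \<in> fst (src p) \<and> und p e = b" using lift_point[OF assms] by blast
  from someI_ex[OF this] show "sec b \<in> fst (src p)" "und p (sec b) = b"
    by (auto simp: sec_def)
qed

text \<open>For an algebra homomorphism the second component of its value at \<open>(e, a)\<close>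
  is independent of \<open>e\<close>, so it descends to a map on the carrier of \<open>y\<close>.
  Lifting of pairs makes this map monotone, and surjectivity of \<open>p\<close> makes it
  unique.\<close>

lemma comparison_full_faithful:
  assumes y: "y \<in> Obj SB" and y': "y' \<in> Obj SB" and k: "k \<in> hom EM (on_obj K y) (on_obj K y')"
  shows "\<exists>!g. g \<in> hom SB y y' \<and> on_arr K g = k"
proof -
  have y1: "y \<in> Arr (PreOrd small)" "tgt y = tgt p" and y1': "y' \<in> Arr (PreOrd small)" "tgt y' = tgt p"
    using y y' by auto
  have my: "monotone_map y" using y1 by (simp add: PreOrd_Arr_iff)
  have y_in: "und y a \<in> fst (tgt p)" if "a \<in> fst (src y)" for a
    using monotone_mapD(3)[OF my that] y1 by simp
  let ?h = "und k"
  have h: "?h \<in> hom SE (pullback_proj1 p y) (pullback_proj1 p y')"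
    using k unfolding em_hom_iff by simp
  note h' = h[unfolded PreOrd_slice_hom_iff]
  define g where "g a = code_snd (und (und ?h) (pair_code (sec (und y a), a)))" for a
  \<comment> \<open>As an arrow over \<open>E\<close>, \<open>?h\<close> preserves the first
    component of a pair.\<close>
  have h_pair: "\<exists>c. und (und ?h) (pair_code (e, a)) = pair_code (e, c) \<and> c \<in> fst (src y') \<and> und y' c = und y a"
    if "e \<in> fst (src p)" "a \<in> fst (src y)" "und p e = und y a" for e a
  proof -
    have m: "pair_code (e, a) \<in> fst (fibre_product p y)" using that by simp
    then have m': "und (und ?h) (pair_code (e, a)) \<in> fst (fibre_product p y')" using h' by auto
    then obtain e' c where c: "und (und ?h) (pair_code (e, a)) = pair_code (e', c)"
      "c \<in> fst (src y')" "und p e' = und y' c" by (elim fibre_productE)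
    have "und (pullback_proj1 p y') (und (und ?h) (pair_code (e, a))) = und (pullback_proj1 p y) (pair_code (e, a))"
      using h' m by auto
    then have "e' = e" using c m m' by simp
    then show ?thesis using c that by auto
  qed
  \<comment> \<open>The homomorphism law is evaluated at \<open>(e, (e', a))\<close>: one side
    forgets \<open>e'\<close> before applying \<open>?h\<close>, the other side afterwards.\<close>
  have h_indep: "code_snd (und (und ?h) (pair_code (e, a))) = code_snd (und (und ?h) (pair_code (e', a)))"
    if hyps: "e \<in> fst (src p)" "a \<in> fst (src y)" "und p e = und y a" "e' \<in> fst (src p)" "und p e' = und y a"
    for e e' a
  proof -
    have "Comp SE ?h (on_arr R (base_change_counit p y))
        = Comp SE (on_arr R (base_change_counit p y')) (on_arr T ?h)"
      using k unfolding em_hom_iff by simp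
    then have "und (und (Comp SE ?h (on_arr R (base_change_counit p y)))) (pair_code (e, pair_code (e', a)))
        = und (und (Comp SE (on_arr R (base_change_counit p y')) (on_arr T ?h))) (pair_code (e, pair_code (e', a)))"
      by simp
    moreover obtain c where c: "und (und ?h) (pair_code (e', a)) = pair_code (e', c)"
      "c \<in> fst (src y')" "und y' c = und y a"
      using h_pair[OF hyps(4,2,5)] by blast
    moreover have "src ?h = pullback_proj1 p y" "tgt ?h = pullback_proj1 p y'"
      "src (und ?h) = fibre_product p y"
      using h' by simp_all
    ultimately show ?thesis using hyps by simp
  qed
  have h_eq: "und (und ?h) (pair_code (e, a)) = pair_code (e, g a)" and g: "g a \<in> fst (src y')" "und y' (g a) = und y a"
    if "e \<in> fst (src p)" "a \<in> fst (src y)" "und p e = und y a" for e a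
    using h_pair[OF that] h_indep[OF that sec(1) sec(2)] y_in[OF that(2)] by (auto simp: g_def)
  have g_in: "g a \<in> fst (src y')" "und y' (g a) = und y a" if "a \<in> fst (src y)" for a
    using g[OF sec(1)[OF y_in] that] sec(2)[OF y_in] that by auto
  have g_mono: "(g a, g a') \<in> snd (src y')" if "(a, a') \<in> snd (src y)" for a a'
  proof -
    have aa: "a \<in> fst (src y)" "a' \<in> fst (src y)"
      using that preordered_set_carrier[OF monotone_mapD(1)[OF my]] by auto
    \<comment> \<open>Monotonicity of \<open>?h\<close> concerns pairs with comparable first
      components, so the relation between the images in \<open>B\<close> has to be lifted to
      \<open>E\<close> first; the values of \<open>sec\<close> need not be comparable.\<close>
    have "(und y a, und y a') \<in> snd (tgt p)" using monotone_mapD(4)[OF my that] y1 by simp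
    then obtain e e' where e: "(e, e') \<in> snd (src p)" "und p e = und y a" "und p e' = und y a'"
      by (elim lift_pair)
    have ee: "e \<in> fst (src p)" "e' \<in> fst (src p)"
      using e preordered_set_carrier[OF E_preordered] by auto
    have "(pair_code (e, a), pair_code (e', a')) \<in> snd (fibre_product p y)" using e that by simp
    then have "(und (und ?h) (pair_code (e, a)), und (und ?h) (pair_code (e', a'))) \<in> snd (fibre_product p y')"
      using h' by auto
    then show ?thesis using h_eq[OF ee(1) aa(1)] h_eq[OF ee(2) aa(2)] e by simp
  qed
  define G where "G = Arrow y (Arrow (src y) (restrict g (fst (src y))) (src y')) y'"
  have G: "G \<in> hom SB y y'"
    unfolding PreOrd_slice_hom_iff using y1 y1' g_in g_mono preordered_set_carrier[OF monotone_mapD(1)[OF my]]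
    by (auto simp: G_def)
  have RG: "on_arr R G = ?h"
  proof (rule PreOrd_slice_eqI[OF R_hom[OF G] h])
    fix z assume "z \<in> fst (src (pullback_proj1 p y))"
    then have "z \<in> fst (fibre_product p y)" by simp
    then show "und (und (on_arr R G)) z = und (und ?h) z"
      by (elim fibre_productE) (simp add: h_eq G_def)
  qed
  have "on_arr K G = k"
    using k RG adj.comparison_functor G unfolding em_hom_iff
    by (auto simp: comparison_functor_def G_def slice_def intro: arrow.expand)
  \<comment> \<open>Every value of \<open>y\<close> has a lift along \<open>p\<close>, so the action
    of \<open>R\<close> on arrows determines them at each \<open>a\<close>.\<close>
  moreover have "G' = G" if G': "G' \<in> hom SB y y'" "on_arr K G' = k" for G'
  proof (rule PreOrd_slice_eqI[OF G'(1) G])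
    fix a assume a: "a \<in> fst (src y)"
    have "und (on_arr K G') = ?h" using G' by simp
    then have "on_arr R G' = on_arr R G" using RG by simp
    then have "und (und (on_arr R G')) (pair_code (sec (und y a), a)) = und (und (on_arr R G)) (pair_code (sec (und y a), a))"
      by simp
    then show "und (und G') a = und (und G) a"
      using a sec[OF y_in[OF a]] G' G unfolding PreOrd_slice_hom_iff by simp
  qed
  ultimately show ?thesis using G by blast
qed

text \<open>The object of \<open>SB\<close> underlying an algebra is its quotient by the transport maps, realised on
  the part of the carrier that lies over the section \<open>sec\<close>.\<close>

lemma comparison_ess_surj:
  assumes A: "A \<in> Obj EM"
  shows "\<exists>y \<in> Obj SB. \<exists>i \<in> hom EM (on_obj K y) A. iso_in EM i"
proof -
  obtain x a where xa: "A = (x, a)" by (cases A)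
  have alg: "(x, a) \<in> algebras" using A xa by simp
  note x = algebra_obj[OF alg] and tr = transport[OF alg] and tr_mono = transport_mono[OF alg]
    and tr_unit = transport_unit[OF alg] and tr_tr = transport_transport[OF alg] and a_hom = algebra_hom[OF alg]
    and x_in = algebra_und[OF alg]
  note a' = a_hom[unfolded PreOrd_slice_hom_iff]
  have mx: "monotone_map x" using x by (simp add: PreOrd_Arr_iff)
  have X: "preordered_set (src x)" using monotone_mapD(1)[OF mx] .
  have p_in: "und p e \<in> fst (tgt p)" if "e \<in> fst (src p)" for e
    using monotone_mapD(3)[OF p_mono that] .
  define \<pi> where "\<pi> z = und p (und x z)" for z
  have \<pi>_in: "\<pi> z \<in> fst (tgt p)" if "z \<in> fst (src x)" for z
    using p_in[OF x_in[OF that]] by (simp add: \<pi>_def)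
  \<comment> \<open>\<open>q z\<close> represents the class of \<open>z\<close>: it is the transport
    of \<open>z\<close> to the chosen point over \<pi> \<open>z\<close>. \<open>Q\<close> collects
    the elements that already lie over chosen points.\<close>
  define q where "q z = transport a (sec (\<pi> z)) z" for z
  define Q where "Q = {z \<in> fst (src x). und x z = sec (\<pi> z)}"
  \<comment> \<open>Two representatives are compared after transport along some related lifts of
    their base points, since the chosen lifts themselves may be unrelated.\<close>
  define le where "le z z' \<longleftrightarrow> z \<in> Q \<and> z' \<in> Q \<and> (\<exists>e e'. (e, e') \<in> snd (src p) \<and> und p e = \<pi> z \<and>
      und p e' = \<pi> z' \<and> (transport a e z, transport a e' z') \<in> snd (src x))" for z z'
  define y where "y = Arrow (Q, {(z, z'). le z z'}) (restrict \<pi> Q) (tgt p)"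
  have Q_sub: "z \<in> fst (src x)" if "z \<in> Q" for z using that by (simp add: Q_def)
  \<comment> \<open>Comparison along one pair of lifts gives it along all: transport the comparison
    at \<open>(d, d')\<close> further to \<open>(e, e')\<close>, where successive transports
    collapse to the last one.\<close>
  have le_all: "(transport a e z, transport a e' z') \<in> snd (src x)"
    if le: "le z z'" and e: "(e, e') \<in> snd (src p)" "und p e = \<pi> z" "und p e' = \<pi> z'" for z z' e e'
  proof -
    obtain d d' where d: "(d, d') \<in> snd (src p)" "und p d = \<pi> z" "und p d' = \<pi> z'"
      "(transport a d z, transport a d' z') \<in> snd (src x)" and z: "z \<in> fst (src x)" "z' \<in> fst (src x)"
      using le Q_sub by (auto simp: le_def)
    note ed = e(1)[THEN preordered_set_carrier[OF E_preordered]] d(1)[THEN preordered_set_carrier[OF E_preordered]]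
    have "(transport a e (transport a d z), transport a e' (transport a d' z')) \<in> snd (src x)"
      using tr_mono[OF e(1) d(4)] tr(2)[of d z] tr(2)[of d' z'] ed z d e by (simp add: \<pi>_def)
    then show ?thesis
      using tr_tr[of e d z] tr_tr[of e' d' z'] ed z d e by (simp add: \<pi>_def)
  qed
  have le_base: "(\<pi> z, \<pi> z') \<in> snd (tgt p)" if "le z z'" for z z'
    using that monotone_mapD(4)[OF p_mono] unfolding le_def by metis
  have Y_pre: "preordered_set (Q, {(z, z'). le z z'})"
  proof (rule preordered_setI)
    show "u \<in> fst (Q, {(z, z'). le z z'}) \<and> v \<in> fst (Q, {(z, z'). le z z'})"
      if "(u, v) \<in> snd (Q, {(z, z'). le z z'})" for u v
      using that by (auto simp: le_def)
    show "(u, u) \<in> snd (Q, {(z, z'). le z z'})" if "u \<in> fst (Q, {(z, z'). le z z'})" for u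
    proof -
      have u: "u \<in> Q" "u \<in> fst (src x)" using that Q_sub by auto
      \<comment> \<open>The lift \<open>und x u\<close> is the one at which transport fixes
        \<open>u\<close>.\<close>
      have "(transport a (und x u) u, transport a (und x u) u) \<in> snd (src x)"
        using u preordered_set_refl[OF X] tr_unit by simp
      then have "le u u"
        using u preordered_set_refl[OF E_preordered x_in[OF u(2)]] by (auto simp: le_def \<pi>_def)
      then show ?thesis by simp
    qed
    show "(u, w) \<in> snd (Q, {(z, z'). le z z'})"
      if "(u, v) \<in> snd (Q, {(z, z'). le z z'})" "(v, w) \<in> snd (Q, {(z, z'). le z z'})" for u v w
    proof -
      have uv: "le u v" and vw: "le v w" using that by auto
      \<comment> \<open>A common lift \<open>e\<^sub>1\<close> of the middle point is required to
        compose the two comparisons; lifting the two pairs separately could give different middle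
        points.\<close>
      obtain e\<^sub>0 e\<^sub>1 e\<^sub>2 where e: "(e\<^sub>0, e\<^sub>1) \<in> snd (src p)" "(e\<^sub>1, e\<^sub>2) \<in> snd (src p)"
        "und p e\<^sub>0 = \<pi> u" "und p e\<^sub>1 = \<pi> v" "und p e\<^sub>2 = \<pi> w"
        using lift_chain[OF le_base[OF uv] le_base[OF vw]] by blast
      have "(transport a e\<^sub>0 u, transport a e\<^sub>2 w) \<in> snd (src x)"
        using preordered_set_trans[OF X le_all[OF uv] le_all[OF vw]] e by blast
      then have "le u w"
        using uv vw e preordered_set_trans[OF E_preordered e(1,2)] by (auto simp: le_def)
      then show ?thesis by simp
    qed
  qed
  have y_mono: "monotone_map y"
    unfolding monotone_map_def using Y_pre B_preordered \<pi>_in Q_sub le_base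
    by (auto simp: y_def le_def)
  have y: "y \<in> Arr (PreOrd small)" "tgt y = tgt p"
    using y_mono x small_subset[of "fst (src x)" Q] Q_sub p_Arr
    by (auto simp: y_def PreOrd_Arr_iff)
  have y_simps: "src y = (Q, {(z, z'). le z z'})" "und y z = \<pi> z" if "z \<in> Q" for z
    using that by (simp_all add: y_def)
  have srcy: "src y = (Q, {(z, z'). le z z'})" by (simp add: y_def)
  \<comment> \<open>\<open>i\<close> restricts the structure map to representatives; its inverse
    \<open>j\<close> records the point of \<open>E\<close> below \<open>z\<close> together with the
    representative of \<open>z\<close>.\<close>
  define i where "i = Arrow (pullback_proj1 p y)
    (Arrow (fibre_product p y) (\<lambda>w \<in> fst (fibre_product p y). und (und a) w) (src x)) x"
  define j where "j = Arrow x
    (Arrow (src x) (\<lambda>z \<in> fst (src x). pair_code (und x z, q z)) (fibre_product p y)) (pullback_proj1 p y)"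
  have i_ap: "und (und i) (pair_code (e, z)) = transport a e z"
    if "e \<in> fst (src p)" "z \<in> Q" "und p e = \<pi> z" for e z
    using that by (simp add: i_def transport_def y_simps)
  have i: "i \<in> hom SE (pullback_proj1 p y) x"
  proof -
    have "(und (und i) w, und (und i) w') \<in> snd (src x)" if "(w, w') \<in> snd (fibre_product p y)" for w w'
      using that y(1)
      by (elim fibre_product_relE') (auto simp: i_ap y_simps srcy intro!: le_all)
    moreover have "und (und i) w \<in> fst (src x) \<and> und x (und (und i) w) = und (pullback_proj1 p y) w"
      if "w \<in> fst (fibre_product p y)" for w
      using that
      by (elim fibre_productE) (auto simp: i_ap y_simps srcy \<pi>_def Q_sub intro!: tr)
    ultimately show ?thesis
      unfolding PreOrd_slice_hom_iff using x pullback_proj1_Arr[OF p_Arr y(1)]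
      by (auto simp: i_def)
  qed
  have q: "q z \<in> Q" "\<pi> (q z) = \<pi> z" if "z \<in> fst (src x)" for z
    using tr[OF sec(1)[OF \<pi>_in[OF that]] that] sec(2)[OF \<pi>_in[OF that]]
    by (auto simp: q_def \<pi>_def Q_def)
  \<comment> \<open>Transporting the representative back over the original point recovers
    \<open>z\<close>, by the associativity and unit laws.\<close>
  have tr_q: "transport a (und x z) (q z) = z" if "z \<in> fst (src x)" for z
    using tr_tr[OF x_in[OF that] sec(1)[OF \<pi>_in[OF that]] that _] sec(2)[OF \<pi>_in[OF that]] tr_unit[OF that]
    by (simp add: q_def \<pi>_def)
  have q_mono: "le (q z) (q z')" if "(z, z') \<in> snd (src x)" for z z'
  proof -
    have z: "z \<in> fst (src x)" "z' \<in> fst (src x)" using preordered_set_carrier[OF X that] by auto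
    have "(und x z, und x z') \<in> snd (src p)" using monotone_mapD(4)[OF mx that] x by simp
    moreover have "(transport a (und x z) (q z), transport a (und x z') (q z')) \<in> snd (src x)"
      using that tr_q z by simp
    moreover have "und p (und x z) = \<pi> (q z)" "und p (und x z') = \<pi> (q z')"
      using q(2) z by (auto simp: \<pi>_def)
    ultimately show ?thesis using q(1) z by (auto simp: le_def)
  qed
  have j: "j \<in> hom SE x (pullback_proj1 p y)"
    unfolding PreOrd_slice_hom_iff using x pullback_proj1_Arr[OF p_Arr y(1)]
    using q q_mono x_in monotone_mapD(4)[OF mx] preordered_set_carrier[OF X]
    by (auto simp: j_def srcy y_simps \<pi>_def)
  have ji: "Comp SE j i = Ident SE (pullback_proj1 p y)"
  proof (rule PreOrd_slice_eqI[OF adj.L.C.comp_hom[OF i j] adj.L.C.ident_hom])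
    show "pullback_proj1 p y \<in> Obj SE" using pullback_proj1_Arr[OF p_Arr y(1)] by simp
    fix w assume "w \<in> fst (src (pullback_proj1 p y))"
    then have w: "w \<in> fst (fibre_product p y)" by simp
    then obtain e z where ez: "w = pair_code (e, z)" "e \<in> fst (src p)" "z \<in> Q" "und p e = \<pi> z"
      by (elim fibre_productE) (auto simp: srcy y_simps)
    note z = Q_sub[OF ez(3)]
    note t = tr[OF ez(2) z ez(4)[unfolded \<pi>_def]]
    have \<pi>t: "\<pi> (transport a e z) = \<pi> z" using t ez by (simp add: \<pi>_def)
    have "q (transport a e z) = transport a (sec (\<pi> z)) z"
      using tr_tr[OF sec(1)[OF \<pi>_in[OF z]] ez(2) z] sec(2)[OF \<pi>_in[OF z]] ez
      unfolding q_def \<pi>t by (simp add: \<pi>_def)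
    also have "\<dots> = z" using tr_unit[OF z] ez(3) by (simp add: Q_def)
    finally have "q (transport a e z) = z" .
    then show "und (und (Comp SE j i)) w = und (und (Ident SE (pullback_proj1 p y))) w"
      using w ez t i_ap[OF ez(2,3,4)] by (simp add: j_def i_def)
  qed
  have ij: "Comp SE i j = Ident SE x"
  proof (rule PreOrd_slice_eqI[OF adj.L.C.comp_hom[OF j i] adj.L.C.ident_hom])
    show "x \<in> Obj SE" using x by simp
    fix z assume z: "z \<in> fst (src x)"
    have "und (und i) (pair_code (und x z, q z)) = z"
      using i_ap[OF x_in[OF z] q(1)[OF z]] q(2)[OF z] tr_q[OF z] by (simp add: \<pi>_def)
    then show "und (und (Comp SE i j)) z = und (und (Ident SE x)) z"
      using z by (simp add: j_def)
  qed
  have yB: "y \<in> Obj SB" using y by simp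
  have Ky: "on_obj K y \<in> algebras"
    using adj.comparison_obj[OF yB] by simp
  \<comment> \<open>At \<open>(e, (e', z))\<close> the left side gives
    \<open>transport a e z\<close> and the right side transports first to \<open>e'\<close> and then
    to \<open>e\<close>; hence \<open>i\<close> is an algebra homomorphism.\<close>
  have comm: "Comp SE i (on_arr R (base_change_counit p y)) = Comp SE a (on_arr T i)"
  proof (rule PreOrd_slice_eqI[OF adj.L.C.comp_hom[OF R_hom[OF counit_hom[OF y]] i]])
    show "Comp SE a (on_arr T i)
        \<in> hom SE (pullback_proj1 p (comp_map p (pullback_proj1 p y))) x"
      using adj.L.C.comp_hom[OF R_hom[OF L_hom[OF i]] a_hom] by simp
    fix w assume "w \<in> fst (src (pullback_proj1 p (comp_map p (pullback_proj1 p y))))"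
    then obtain e e' z where w: "w = pair_code (e, pair_code (e', z))" "e \<in> fst (src p)" "e' \<in> fst (src p)"
      "z \<in> Q" "und p e' = \<pi> z" "und p e = und p e'"
      by (auto simp: srcy y_simps elim!: fibre_productE)
    have "transport a e (transport a e' z) = transport a e z"
      using tr_tr[of e e' z] w Q_sub by (simp add: \<pi>_def)
    moreover have "und (und a) (pair_code (e, und (und i) (pair_code (e', z)))) = transport a e (transport a e' z)"
      using i_ap[of e' z] w by (simp add: transport_def)
    moreover have "src i = pullback_proj1 p y" "src (und i) = fibre_product p y" by (simp_all add: i_def)
    ultimately show "und (und (Comp SE i (on_arr R (base_change_counit p y)))) w = und (und (Comp SE a (on_arr T i))) w"
      using w by (simp add: i_ap srcy y_simps)
  qed
  have I: "Arrow (on_obj K y) i A \<in> hom EM (on_obj K y) A"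
    unfolding em_hom_iff using Ky alg i comm by (simp add: xa)
  have "iso_in EM (Arrow (on_obj K y) i A)"
    by (rule em_iso_inI[OF adj.functor_monad I, of j]) (use j ji ij in \<open>simp_all add: xa\<close>)
  then show ?thesis using I yB by blast
qed

lemma effective_descent: "effective_descent small p"
proof -
  have "is_equivalence SB EM K"
    using equivalence_if_full_faithful_ess_surj[OF adj.comparison_functor]
      comparison_full_faithful comparison_ess_surj by blast
  then show ?thesis
    unfolding effective_descent_def monadic_def using base_change_adjunction p_Arr by blast
qed

end

section \<open>Effective descent morphisms are surjective\<close>

text \<open>If \<open>p\<close> missed the point \<open>b\<close>, then the pullback functor would not distinguish the inclusion
  of \<open>b\<close> from the empty map, although there is no map from the former to the latter.\<close>

lemma (in base_change) effective_descent_surj: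
  assumes eff: "effective_descent small p" and b: "b \<in> fst (tgt p)"
  shows "\<exists>e \<in> fst (src p). und p e = b"
proof (rule ccontr)
  assume no: "\<not> ?thesis"
  \<comment> \<open>Monadicity asserts the existence of some left adjoint, so \<open>L'\<close>,
    \<open>u\<close> and \<open>c\<close> may differ from the adjunction constructed above.\<close>
  obtain L' u c where adj: "adjunction SE SB L' R u c"
    and equiv: "is_equivalence SB (em_category SE (R \<circ>\<^sub>F L') u (\<lambda>x. on_arr R (c (on_obj L' x))))
       (comparison_functor SB R c)" (is "is_equivalence _ ?M ?K")
    using eff unfolding effective_descent_def monadic_def by blast
  interpret adj: adjunction SE SB L' R u c by (rule adj)
  define y\<^sub>1 :: "('u, 'u) monotone_map" where "y\<^sub>1 = Arrow ({b}, {(b, b)}) (\<lambda>x\<in>{b}. b) (tgt p)"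
  define y\<^sub>0 :: "('u, 'u) monotone_map" where "y\<^sub>0 = Arrow ({}, {}) (\<lambda>x\<in>{}. b) (tgt p)"
  define P :: "('u, 'u) monotone_map" where "P = Arrow ({}, {}) (\<lambda>x\<in>{}. b) (src p)"
  have obj: "y\<^sub>0 \<in> Obj SB" "y\<^sub>1 \<in> Obj SB"
    using b B_preordered p_Arr small_finite preordered_set_refl[OF B_preordered b]
    by (auto simp: y\<^sub>0_def y\<^sub>1_def PreOrd_Arr_iff monotone_map_def intro!: preordered_setI)
  have "fibre_product p y\<^sub>1 = ({}, {})"
    using no preordered_set_carrier[OF E_preordered] by (auto simp: fibre_product_def y\<^sub>1_def)
  then have P1: "pullback_proj1 p y\<^sub>1 = P"
    by (simp add: P_def pullback_proj1_def restrict_def)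
  have P0: "pullback_proj1 p y\<^sub>0 = P"
    by (simp add: P_def pullback_proj1_def fibre_product_def y\<^sub>0_def restrict_def)
  have P: "P \<in> Obj SE" using adj.R.obj_obj[OF obj(1)] P0 by simp
  have c: "on_arr R (c y) \<in> hom SE (pullback_proj1 p (on_obj L' (pullback_proj1 p y))) (pullback_proj1 p y)"
    if "y \<in> Obj SB" for y
    using adj.R.arr_hom[OF adj.counit.component[OF that]] by simp
  note c0 = c[OF obj(1), unfolded P0] and c1 = c[OF obj(2), unfolded P1]
  \<comment> \<open>Both arrows have the same source and target, and the target \<open>P\<close> has
    empty carrier. So the source is empty as well and the arrows agree, which makes the two
    comparison algebras equal.\<close>
  have "on_arr R (c y\<^sub>1) = on_arr R (c y\<^sub>0)"
    using PreOrd_slice_eqI[OF c1 c0] c1 unfolding PreOrd_slice_hom_iff by (auto simp: P_def)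
  moreover have "on_arr R (on_arr L' (Ident SE P)) = Ident SE (pullback_proj1 p (on_obj L' P))"
    using adj.L.arr_ident[OF P] adj.R.arr_ident[OF adj.L.obj_obj[OF P]] by simp
  moreover have "(P, on_arr R (c y\<^sub>0)) \<in> em_algebras SE (R \<circ>\<^sub>F L') u (\<lambda>x. on_arr R (c (on_obj L' x)))"
    using adj.comparison_obj[OF obj(1)] P0 by simp
  ultimately have "Arrow (on_obj ?K y\<^sub>1) (Ident SE P) (on_obj ?K y\<^sub>0) \<in> hom ?M (on_obj ?K y\<^sub>1) (on_obj ?K y\<^sub>0)"
    using obj P0 P1 adj.L.C.ident_hom[OF P] adj.L.C.comp_ident_left[OF c0] adj.L.C.comp_ident_right[OF c0]
    unfolding em_hom_iff by (simp add: comparison_functor_def del: slice_simps)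
  then obtain h where "h \<in> hom SB y\<^sub>1 y\<^sub>0"
    using equivalence_reflects_hom[OF equiv obj(2,1)] by blast
  then show False
    unfolding PreOrd_slice_hom_iff by (auto simp: y\<^sub>0_def y\<^sub>1_def)
qed

section \<open>A chain-lifting map with partially ordered domain\<close>

text \<open>The carrier codes \<open>B \<times> {0, 1, 2}\<close>, with \<open>(b, i)\<close> strictly below \<open>(b', j)\<close> iff \<open>b \<le> b'\<close> and
  \<open>i < j\<close>.\<close>

definition three_levels :: "(nat \<Rightarrow> 'u) \<Rightarrow> 'u preset \<Rightarrow> 'u preset" where
  "three_levels t Y =
     ({pair_code (b, t i) | b i. b \<in> fst Y \<and> i \<le> 2},
      {(pair_code (b, t i), pair_code (b', t j)) | b i b' j.
        b \<in> fst Y \<and> b' \<in> fst Y \<and> i \<le> 2 \<and> j \<le> 2 \<and>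
        (b = b' \<and> i = j \<or> (b, b') \<in> snd Y \<and> i < j)})"

definition three_level_cover :: "(nat \<Rightarrow> 'u) \<Rightarrow> 'u preset \<Rightarrow> ('u, 'u) monotone_map" where
  "three_level_cover t Y =
     Arrow (three_levels t Y) (\<lambda>z \<in> fst (three_levels t Y). code_fst z) Y"

context set_universe
begin

context
  fixes t :: "nat \<Rightarrow> 'u" and Y :: "'u preset"
  assumes t: "inj t" and Y: "Y \<in> Obj (PreOrd small)"
begin

lemma three_levels_mem [simp]:
  "pair_code (b, t i) \<in> fst (three_levels t Y) \<longleftrightarrow> b \<in> fst Y \<and> i \<le> 2"
  using t by (auto simp: three_levels_def inj_eq)

lemma three_levels_rel [simp]:
  "(pair_code (b, t i), pair_code (b', t j)) \<in> snd (three_levels t Y) \<longleftrightarrow>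
     b \<in> fst Y \<and> b' \<in> fst Y \<and> i \<le> 2 \<and> j \<le> 2 \<and> (b = b' \<and> i = j \<or> (b, b') \<in> snd Y \<and> i < j)"
  using t by (auto simp: three_levels_def inj_eq)

lemma three_levelsE:
  assumes "z \<in> fst (three_levels t Y)"
  obtains b i where "z = pair_code (b, t i)" "b \<in> fst Y" "i \<le> 2"
  using assms by (auto simp: three_levels_def)

lemma three_levels_relE:
  assumes "(z, z') \<in> snd (three_levels t Y)"
  obtains b i b' j where "z = pair_code (b, t i)" "z' = pair_code (b', t j)"
    "b \<in> fst Y" "b' \<in> fst Y" "i \<le> 2" "j \<le> 2" "b = b' \<and> i = j \<or> (b, b') \<in> snd Y \<and> i < j"
  using assms by (auto simp: three_levels_def)

lemma three_levels_preordered: "preordered_set (three_levels t Y)"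
proof (rule preordered_setI)
  show "(x, z) \<in> snd (three_levels t Y)"
    if xy: "(x, y) \<in> snd (three_levels t Y)" and yz: "(y, z) \<in> snd (three_levels t Y)" for x y z
  proof -
    obtain b i b' j where 1: "x = pair_code (b, t i)" "y = pair_code (b', t j)"
      "b \<in> fst Y" "b' \<in> fst Y" "i \<le> 2" "j \<le> 2" "b = b' \<and> i = j \<or> (b, b') \<in> snd Y \<and> i < j"
      using xy by (rule three_levels_relE)
    obtain c' j' c k where 2: "y = pair_code (c', t j')" "z = pair_code (c, t k)"
      "c \<in> fst Y" "k \<le> 2" "c' = c \<and> j' = k \<or> (c', c) \<in> snd Y \<and> j' < k"
      using yz by (rule three_levels_relE)
    have "c' = b'" "j' = j" using 1(2) 2(1) t by (auto simp: inj_eq)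
    then show ?thesis
      using 1 2 preordered_set_trans[of Y b b' c] Y by auto
  qed
qed (auto elim!: three_levels_relE three_levelsE)

text \<open>A comparison between distinct elements strictly raises the level, so it cannot be
  reversed.\<close>

lemma three_levels_antisym: "antisym (snd (three_levels t Y))"
proof (rule antisymI)
  fix x y
  assume xy: "(x, y) \<in> snd (three_levels t Y)" and yx: "(y, x) \<in> snd (three_levels t Y)"
  obtain b i b' j where 1: "x = pair_code (b, t i)" "y = pair_code (b', t j)"
    using xy by (rule three_levels_relE)
  then show "x = y" using xy yx by auto
qed

text \<open>The three points of a chain are placed at levels 0, 1 and 2, so that the lifted chain is
  strictly increasing even where the given one has repetitions or cycles.\<close>

lemma three_level_cover_chain_lifting: "chain_lifting small (three_level_cover t Y)"
proof -
  let ?p = "three_level_cover t Y"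
  have Y': "small (fst Y)" "preordered_set Y" using Y by auto
  have "fst (three_levels t Y) = (\<Union>i\<in>{..2}. (\<lambda>b. pair_code (b, t i)) ` fst Y)"
    by (auto simp: three_levels_def)
  \<comment> \<open>The union is reindexed by level codes, because \<open>small_UN\<close> takes its
    index set in the type \<open>'u\<close>.\<close>
  then have "fst (three_levels t Y) = (\<Union>i\<in>t ` {..2}. (\<lambda>b. pair_code (b, i)) ` fst Y)"
    by simp
  then have "small (fst (three_levels t Y))"
    using small_UN[OF small_finite small_image[OF Y'(1)], of "t ` {..2}"] by simp
  moreover have "monotone_map ?p"
    unfolding monotone_map_def using Y' three_levels_preordered
    by (auto simp: three_level_cover_def preordered_set_refl elim!: three_levelsE three_levels_relE)
  ultimately have "?p \<in> Arr (PreOrd small)"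
    using Y' by (simp add: PreOrd_Arr_iff three_level_cover_def)
  moreover have "\<exists>e\<^sub>0 e\<^sub>1 e\<^sub>2. (e\<^sub>0, e\<^sub>1) \<in> snd (src ?p) \<and> (e\<^sub>1, e\<^sub>2) \<in> snd (src ?p) \<and>
      und ?p e\<^sub>0 = b\<^sub>0 \<and> und ?p e\<^sub>1 = b\<^sub>1 \<and> und ?p e\<^sub>2 = b\<^sub>2"
    if "(b\<^sub>0, b\<^sub>1) \<in> snd (tgt ?p)" "(b\<^sub>1, b\<^sub>2) \<in> snd (tgt ?p)" for b\<^sub>0 b\<^sub>1 b\<^sub>2
  proof -
    have "(b\<^sub>0, b\<^sub>1) \<in> snd Y" "(b\<^sub>1, b\<^sub>2) \<in> snd Y" using that by (auto simp: three_level_cover_def)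
    moreover from this have "b\<^sub>0 \<in> fst Y" "b\<^sub>1 \<in> fst Y" "b\<^sub>2 \<in> fst Y"
      using preordered_set_carrier[OF Y'(2)] by auto
    ultimately show ?thesis
      by (intro exI[of _ "pair_code (b\<^sub>0, t 0)"] exI[of _ "pair_code (b\<^sub>1, t 1)"]
          exI[of _ "pair_code (b\<^sub>2, t 2)"]) (simp add: three_level_cover_def)
  qed
  ultimately show ?thesis
    by unfold_locales
qed

end

section \<open>Trivial coverings\<close>

text \<open>Antisymmetry makes all classes singletons, so the reflection of a partial order is the
  same order with \<open>a\<close> renamed to \<open>{a}\<close>.\<close>

lemma
  assumes X: "preordered_set X" and anti: "antisym (snd X)"
  shows sim_partial_order: "a \<in> fst X \<Longrightarrow> sim X `` {a} = {a}"
    and F_obj_partial_order: "fst (F_obj X) = (\<lambda>a. {a}) ` fst X"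
      "snd (F_obj X) = {({a}, {a'}) | a a'. (a, a') \<in> snd X}"
proof -
  show sim: "sim X `` {a} = {a}" if "a \<in> fst X" for a
    using that preordered_set_refl[OF X] anti by (auto simp: sim_def antisym_def)
  show "fst (F_obj X) = (\<lambda>a. {a}) ` fst X"
    using sim by (auto simp: F_obj_def quotient_def)
  have "(sim X `` {a}, sim X `` {a'}) = ({a}, {a'})" if "(a, a') \<in> snd X" for a a'
    using sim preordered_set_carrier[OF X that] by simp
  then show "snd (F_obj X) = {({a}, {a'}) | a a'. (a, a') \<in> snd X}"
    unfolding F_obj_def by (auto; metis)
qed

lemma F_obj_preordered_partial_order:
  assumes "preordered_set X" "antisym (snd X)"
  shows "preordered_set (F_obj X)"
  using preordered_set_refl[OF assms(1)] preordered_set_carrier[OF assms(1)]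
    preordered_set_trans[OF assms(1)]
  by (intro preordered_setI) (auto simp: F_obj_partial_order[OF assms])

text \<open>Both units merely rename \<open>a\<close> to \<open>{a}\<close>, and a commutative
  square with two parallel isomorphisms is a pullback. The mediating map is obtained from
  \<open>w\<close> by extracting the element of each singleton.\<close>

lemma trivial_covering_partial_orders:
  fixes g :: "('u, 'u) monotone_map"
  assumes g: "g \<in> Arr (PreOrd small)"
    and antisym: "antisym (snd (src g))" "antisym (snd (tgt g))"
  shows "trivial_covering small g"
proof -
  have mg: "monotone_map g" using g by (simp add: PreOrd_Arr_iff)
  note X = monotone_mapD(1)[OF mg] and Y = monotone_mapD(2)[OF mg]
  note simX = sim_partial_order[OF X antisym(1)] and simY = sim_partial_order[OF Y antisym(2)]
  note FX = F_obj_partial_order[OF X antisym(1)] and FY = F_obj_partial_order[OF Y antisym(2)]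
  note preF = F_obj_preordered_partial_order[OF X antisym(1)]
    F_obj_preordered_partial_order[OF Y antisym(2)]
  have eta: "und (eta (src g)) a = {a}" if "a \<in> fst (src g)" for a
    using that simX by (simp add: eta_def)
  have eta': "und (eta (tgt g)) a = {a}" if "a \<in> fst (tgt g)" for a
    using that simY by (simp add: eta_def)
  have F: "und (F_arr g) {a} = {und g a}" if "a \<in> fst (src g)" for a
    using that simY monotone_mapD(3)[OF mg] by (simp add: F_arr_def FX)
  have m_eta: "monotone_map (eta (src g))" "monotone_map (eta (tgt g))"
    unfolding monotone_map_def using X Y preF preordered_set_carrier[OF X] preordered_set_carrier[OF Y]
    by (auto simp: eta_def simX simY FX FY)
  have m_F: "monotone_map (F_arr g)"
    unfolding monotone_map_def using preF F monotone_mapD[OF mg] preordered_set_carrier[OF X]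
    by (auto simp: F_arr_def FX FY simY)
  have src_tgt: "src (eta Z) = Z" "tgt (eta Z) = F_obj Z" "src (F_arr g) = F_obj (src g)"
    "tgt (F_arr g) = F_obj (tgt g)" for Z :: "'u preset"
    by (auto simp: eta_def F_arr_def)
  have comm: "comp_map (eta (tgt g)) g = comp_map (F_arr g) (eta (src g))"
    by (intro monotone_map_eqI monotone_map_comp)
      (simp_all add: mg m_eta m_F src_tgt eta eta' F monotone_mapD(3)[OF mg])
  have univ: "\<exists>!k :: ('u, 'u) monotone_map. monotone_map k \<and> src k = src v \<and> tgt k = src g \<and>
      comp_map g k = v \<and> comp_map (eta (src g)) k = w"
    if v: "monotone_map v" "tgt v = tgt g" and w: "monotone_map w" "tgt w = F_obj (src g)"
      and vw: "src v = src w" "comp_map (eta (tgt g)) v = comp_map (F_arr g) w"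
    for v :: "('u, 'u) monotone_map" and w :: "('u, 'u set) monotone_map"
  proof -
    define k :: "('u, 'u) monotone_map"
      where "k = Arrow (src v) (\<lambda>z \<in> fst (src v). the_elem (und w z)) (src g)"
    have k_in: "und k z \<in> fst (src g)" and wk: "und w z = {und k z}" if "z \<in> fst (src v)" for z
    proof -
      have "und w z \<in> (\<lambda>a. {a}) ` fst (src g)"
        using monotone_mapD(3)[OF w(1), of z] that vw(1) w(2) by (simp add: FX)
      then obtain a where a: "a \<in> fst (src g)" "und w z = {a}" by blast
      have "und k z = a" using that a(2) by (simp add: k_def)
      then show "und k z \<in> fst (src g)" "und w z = {und k z}" using a by simp_all
    qed
    have "(und k z, und k z') \<in> snd (src g)" if "(z, z') \<in> snd (src v)" for z z'
    proof -
      have "(und w z, und w z') \<in> snd (F_obj (src g))"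
        using monotone_mapD(4)[OF w(1), of z z'] that vw(1) w(2) by simp
      then show ?thesis
        using wk preordered_set_carrier[OF monotone_mapD(1)[OF v(1)] that] by (auto simp: FX)
    qed
    then have k: "monotone_map k"
      unfolding monotone_map_def using X monotone_mapD(1)[OF v(1)] k_in by (auto simp: k_def)
    have sk: "src k = src v" "tgt k = src g" by (simp_all add: k_def)
    have "und g (und k z) = und v z" if z: "z \<in> fst (src v)" for z
    proof -
      have "und (comp_map (eta (tgt g)) v) z = und (comp_map (F_arr g) w) z" using vw by simp
      then show ?thesis
        using z vw(1) v(2) wk[OF z] k_in[OF z] monotone_mapD(3)[OF v(1) z] by (simp add: eta' F)
    qed
    then have "comp_map g k = v"
      using v sk by (intro monotone_map_eqI monotone_map_comp[OF k mg]) auto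
    moreover have "comp_map (eta (src g)) k = w"
      using w vw(1) sk wk k_in
      by (intro monotone_map_eqI monotone_map_comp[OF k m_eta(1)]) (auto simp: src_tgt eta)
    moreover have "k' = k" if k': "monotone_map k'" "src k' = src v" "tgt k' = src g"
      "comp_map (eta (src g)) k' = w" for k'
    proof (rule monotone_map_eqI[OF k'(1) k])
      fix z assume z: "z \<in> fst (src k')"
      then have "und w z = {und k' z}"
        using k'(4) eta monotone_mapD(3)[OF k'(1) z] k'(3) comp_map_simps(3)[OF z] by metis
      then show "und k' z = und k z" using wk z k' by simp
    qed (use k' sk in auto)
    ultimately show ?thesis using k sk by blast
  qed
  show ?thesis
    unfolding trivial_covering_def pullback_square_def
    using g mg m_eta m_F comm univ by (auto simp: src_tgt)
qed

text \<open>Equivalent elements have the same class. If they also have the same image under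
  \<open>g\<close>, then, viewed as maps from a point, they induce the same cone over the pullback
  square and agree by uniqueness.\<close>

lemma trivial_covering_inj:
  fixes g :: "('u, 'u) monotone_map"
  assumes tc: "trivial_covering small g"
    and z: "(z, z') \<in> snd (src g)" "(z', z) \<in> snd (src g)" "und g z = und g z'"
  shows "z = z'"
proof -
  have mg: "monotone_map g" using tc by (simp add: trivial_covering_def PreOrd_Arr_iff)
  note X = monotone_mapD(1)[OF mg]
  have sq: "pullback_square small g (eta (src g)) (eta (tgt g)) (F_arr g)"
    using tc by (simp add: trivial_covering_def)
  have m_eta: "monotone_map (eta (src g))" and src_eta: "src g = src (eta (src g))"
    and comm: "comp_map (eta (tgt g)) g = comp_map (F_arr g) (eta (src g))"
    and univ: "\<And>v w. small (fst (src v)) \<and> monotone_map v \<and> monotone_map w \<and> src v = src w \<and>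
      tgt v = src (eta (tgt g)) \<and> tgt w = src (F_arr g) \<and>
      comp_map (eta (tgt g)) v = comp_map (F_arr g) w \<Longrightarrow>
      \<exists>!k :: ('u, 'u) monotone_map. monotone_map k \<and> src k = src v \<and> tgt k = src g \<and>
        comp_map g k = v \<and> comp_map (eta (src g)) k = w"
    and ends: "tgt g = src (eta (tgt g))" "tgt (eta (src g)) = src (F_arr g)"
    using sq unfolding pullback_square_def by blast+
  have zX: "z \<in> fst (src g)" "z' \<in> fst (src g)" using preordered_set_carrier[OF X z(1)] by auto
  have eta_eq: "und (eta (src g)) z = und (eta (src g)) z'"
    using zX z preordered_set_trans[OF X] by (auto simp: eta_def sim_def)
  \<comment> \<open>The element \<open>w\<close> as a map from a one-point preordered set. The
    carrier \<open>{z}\<close> is just a convenient singleton, kept fixed so that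
    \<open>pt z\<close> and \<open>pt z'\<close> have the same source.\<close>
  define pt :: "'u \<Rightarrow> ('u, 'u) monotone_map"
    where "pt w = Arrow ({z}, {(z, z)}) (\<lambda>_ \<in> {z}. w) (src g)" for w
  have pt: "monotone_map (pt w)" if "w \<in> fst (src g)" for w
    using that X preordered_set_refl[OF X that]
    by (auto simp: monotone_map_def pt_def intro!: preordered_setI)
  have pt_simps: "src (pt w) = ({z}, {(z, z)})" "tgt (pt w) = src g" "und (pt w) z = w" for w
    by (simp_all add: pt_def)
  let ?v = "comp_map g (pt z)" and ?w = "comp_map (eta (src g)) (pt z)"
  have eq: "comp_map g (pt z') = ?v" "comp_map (eta (src g)) (pt z') = ?w"
    using z(3) eta_eq by (auto simp: comp_map_def pt_def compose_def fun_eq_iff)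
  have "comp_map (eta (tgt g)) ?v = comp_map (F_arr g) ?w"
    using comp_map_assoc[OF pt[OF zX(1)], of g] comp_map_assoc[OF pt[OF zX(1)], of "eta (src g)"]
      comm src_eta by (metis pt_simps(2))
  moreover have "monotone_map ?v" "monotone_map ?w"
    using monotone_map_comp[OF pt[OF zX(1)] mg] monotone_map_comp[OF pt[OF zX(1)] m_eta] src_eta
    by (simp_all add: pt_simps)
  moreover have "small (fst (src ?v))" using small_finite by (simp add: pt_simps)
  ultimately have "\<exists>!k :: ('u, 'u) monotone_map. monotone_map k \<and> src k = src ?v \<and> tgt k = src g \<and>
      comp_map g k = ?v \<and> comp_map (eta (src g)) k = ?w"
    using univ[of ?v ?w] ends by (simp add: pt_simps)
  moreover have "monotone_map (pt w) \<and> src (pt w) = src ?v \<and> tgt (pt w) = src g \<and>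
      comp_map g (pt w) = ?v \<and> comp_map (eta (src g)) (pt w) = ?w" if "w \<in> {z, z'}" for w
    using that pt zX eq by (elim insertE) (simp_all add: pt_simps(1,2))
  ultimately have "pt z = pt z'" by blast
  then show ?thesis using pt_simps(3) by metis
qed

text \<open>Smallness, reflexivity and transitivity pass to the fibre, so membership amounts to
  antisymmetry there.\<close>

lemma fibre_ParOrd_iff:
  fixes f :: "('u, 'u) monotone_map"
  assumes "f \<in> Arr (PreOrd small)"
  shows "fibre f b \<in> Obj (ParOrd small) \<longleftrightarrow>
    (\<forall>a a'. (a, a') \<in> snd (src f) \<longrightarrow> (a', a) \<in> snd (src f) \<longrightarrow> und f a = b \<longrightarrow> und f a' = b \<longrightarrow> a = a')"
proof -
  have X: "preordered_set (src f)" and s: "small (fst (src f))"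
    using assms monotone_mapD(1) by (auto simp: PreOrd_Arr_iff)
  have "preordered_set (fibre f b)"
    by (rule preordered_setI)
      (auto simp: fibre_def Let_def intro: preordered_set_refl[OF X] preordered_set_trans[OF X])
  moreover have "small (fst (fibre f b))"
    by (rule small_subset[OF s]) (auto simp: fibre_def Let_def)
  ultimately show ?thesis
    using preordered_set_carrier[OF X]
    by (auto simp: ParOrd_def partial_order_on_def preordered_set_def antisym_def fibre_def Let_def)
qed

end

section \<open>Coverings and the order on their fibres\<close>

theorem proposition2p4:
  fixes small :: "'u set \<Rightarrow> bool"
    and A B :: "'u set" and \<rho> \<sigma> :: "'u rel"
    and f :: "('u, 'u) monotone_map"
  assumes "set_universe small"
    and "f \<in> hom (PreOrd small) (A, \<rho>) (B, \<sigma>)"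
  shows "covering small f \<longleftrightarrow> (\<forall>b \<in> B. fibre f b \<in> Obj (ParOrd small))"
proof -
  interpret set_universe small by fact
  have f: "f \<in> Arr (PreOrd small)" "src f = (A, \<rho>)" "tgt f = (B, \<sigma>)"
    using assms(2) by (auto simp: hom_iff)
  have mf: "monotone_map f" using f by (simp add: PreOrd_Arr_iff)
  show ?thesis
  proof
    assume "covering small f"
    then obtain p where p: "effective_descent small p" "tgt p = tgt f"
      "trivial_covering small (pullback_proj1 p f)"
      by (auto simp: covering_def)
    interpret base_change small p
      using p(1) by unfold_locales (simp add: effective_descent_def)
    show "\<forall>b \<in> B. fibre f b \<in> Obj (ParOrd small)"
      unfolding fibre_ParOrd_iff[OF f(1)]
    proof safe
      fix a a'
      assume a: "und f a \<in> B" "(a, a') \<in> snd (src f)" "(a', a) \<in> snd (src f)" "und f a' = und f a"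
      \<comment> \<open>Surjectivity of \<open>p\<close> puts both \<open>a\<close> and
        \<open>a'\<close> into the pullback over one and the same point \<open>e\<close>.\<close>
      obtain e where e: "e \<in> fst (src p)" "und p e = und f a"
        using effective_descent_surj[OF p(1), of "und f a"] a(1) p(2) f(3) by auto
      have a_in: "a \<in> fst (src f)" "a' \<in> fst (src f)"
        using preordered_set_carrier[OF monotone_mapD(1)[OF mf] a(2)] by auto
      have "pair_code (e, a) = pair_code (e, a')"
        by (rule trivial_covering_inj[OF p(3)])
          (use a a_in e preordered_set_refl[OF E_preordered e(1)] in simp_all)
      then show "a = a'" by simp
    qed
  next
    assume fib: "\<forall>b \<in> B. fibre f b \<in> Obj (ParOrd small)"
    \<comment> \<open>Codes in \<open>'u\<close> for the three levels; they exist because the type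
      is infinite.\<close>
    obtain t :: "nat \<Rightarrow> 'u" where t: "inj t"
      using infinite_countable_subset[OF infinite_univ] by auto
    have Y: "(B, \<sigma>) \<in> Obj (PreOrd small)"
      using f(1,3) monotone_mapD(2)[OF mf] by (simp add: PreOrd_Arr_iff)
    define p where "p = three_level_cover t (B, \<sigma>)"
    interpret chain_lifting small p
      unfolding p_def by (rule three_level_cover_chain_lifting[OF t Y])
    have p: "src p = three_levels t (B, \<sigma>)" "tgt p = tgt f"
      using f by (simp_all add: p_def three_level_cover_def)
    have anti_p: "antisym (snd (src p))" using three_levels_antisym[OF t Y] p by simp
    \<comment> \<open>First components agree because the domain of \<open>p\<close> is partially
      ordered; equivalent second components then lie in the same fibre of \<open>f\<close>, where
      the hypothesis makes them equal.\<close>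
    have "antisym (snd (fibre_product p f))"
    proof (rule antisymI)
      fix z z'
      assume z: "(z, z') \<in> snd (fibre_product p f)" "(z', z) \<in> snd (fibre_product p f)"
      obtain e a e' a' where *: "z = pair_code (e, a)" "z' = pair_code (e', a')"
        using z(1) by (rule fibre_product_relE)
      have "e = e'" using z * antisymD[OF anti_p] by auto
      moreover have a: "(a, a') \<in> snd (src f)" "(a', a) \<in> snd (src f)"
        "und p e = und f a" "und p e' = und f a'"
        using z * by auto
      moreover have "und f a \<in> B"
        using preordered_set_carrier[OF monotone_mapD(1)[OF mf] a(1)] monotone_mapD(3)[OF mf] f(3) by auto
      ultimately show "z = z'"
        using fib fibre_ParOrd_iff[OF f(1)] * by metis
    qed
    then have "trivial_covering small (pullback_proj1 p f)"
      using trivial_covering_partial_orders[OF pullback_proj1_Arr[OF p_Arr f(1)]] anti_p by simp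
    then show "covering small f"
      unfolding covering_def using f(1) effective_descent p(2) by blast
  qed
qed

end
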